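(* Let $N$ be a positive integer. For every $N$-bounded $\mathit{FO}(<,+1)$ formula $\varphi(x)$ there exists an MTL formula $\varphi^\dagger$ equivalent to $\varphi(x)$, i.e. for every signal $f$ and every $r\in\mathbb{R}$, $f\models\varphi[r]$ iff $f,r\models\varphi^\dagger$.
   Context: $\mathit{FO}(<,+1)$ is first-order logic with binary relation $<$, unary predicates $P_1,P_2,\ldots$, and the unary function $+1$ (terms $t::=x\mid t+1$; formulas $\mathbf{true}\mid P_i(t)\mid t<t\mid\wedge\mid\neg\mid\exists$), interpreted over $\mathbb{R}$ with usual order and addition of $1$; arithmetical shorthands such as $x-N\le z$ (meaning $x\le z+1+\cdots+1$) are used. A signal over a finite set $\boldsymbol{P}$ of predicates is a function $f:\mathbb{R}\to2^{\boldsymbol{P}}$, with $P(r)$ true iff $P\in f(r)$. For terms $t_1,t_2$, $\mathrm{Bet}(t_1,t_2)$ is the set of $\mathit{FO}(<,+1)$ formulas in which (i) every subformula $\exists z\,\psi$ has the form $\exists z\,((t_1\le z<t_2)\wedge\chi)$, and (ii) in every atomic subformula $P(t)$ the term $t$ is a bound occurrence of a variable. A formula $\varphi(x)$ is $N$-bounded if it belongs to $\mathrm{Bet}(x-N,x+N)$. MTL formulas over $\boldsymbol{P}$: $\varphi::=\mathbf{true}\mid p\mid\varphi\wedge\varphi\mid\neg\varphi\mid \varphi_1\,\mathbf{U}_I\,\varphi_2\mid\varphi_1\,\mathbf{S}_I\,\varphi_2$, with $I\subseteq(0,\infty)$ an interval with endpoints in $\mathbb{Q}_{\ge0}\cup\{\infty\}$.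 Semantics: $f,r\models p$ iff $p\in f(r)$; Booleans as usual; $f,r\models\varphi_1\,\mathbf{U}_I\,\varphi_2$ iff there is $t>r$ with $t-r\in I$, $f,t\models\varphi_2$ and $f,u\models\varphi_1$ for all $r<u<t$; $f,r\models\varphi_1\,\mathbf{S}_I\,\varphi_2$ iff there is $t<r$ with $r-t\in I$, $f,t\models\varphi_2$ and $f,u\models\varphi_1$ for all $t<u<r$. *)

theory Defs
  imports Complex_Main
begin

datatype trm = Var nat | Plus1 trm

datatype (fo_preds: 'p) fo =
    TrueF
  | Pred 'p trm
  | Less trm trm
  | AndF "'p fo" "'p fo"
  | NotF "'p fo"
  | ExF nat "'p fo"

primrec trm_var :: "trm \<Rightarrow> nat" where
  "trm_var (Var x) = x"
| "trm_var (Plus1 t) = trm_var t"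

primrec fo_free :: "'p fo \<Rightarrow> nat set" where
  "fo_free TrueF = {}"
| "fo_free (Pred p t) = {trm_var t}"
| "fo_free (Less s t) = {trm_var s, trm_var t}"
| "fo_free (AndF \<phi> \<psi>) = fo_free \<phi> \<union> fo_free \<psi>"
| "fo_free (NotF \<phi>) = fo_free \<phi>"
| "fo_free (ExF z \<phi>) = fo_free \<phi> - {z}"

definition signal :: "'p set \<Rightarrow> (real \<Rightarrow> 'p set) \<Rightarrow> bool" where
  "signal P f \<longleftrightarrow> (\<forall>r. f r \<subseteq> P)"

primrec trm_val :: "(nat \<Rightarrow> real) \<Rightarrow> trm \<Rightarrow> real" where
  "trm_val v (Var x) = v x"
| "trm_val v (Plus1 t) = trm_val v t + 1"

primrec fo_sat :: "(real \<Rightarrow> 'p set) \<Rightarrow> (nat \<Rightarrow> real) \<Rightarrow> 'p fo \<Rightarrow> bool" where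
  "fo_sat f v TrueF \<longleftrightarrow> True"
| "fo_sat f v (Pred p t) \<longleftrightarrow> p \<in> f (trm_val v t)"
| "fo_sat f v (Less s t) \<longleftrightarrow> trm_val v s < trm_val v t"
| "fo_sat f v (AndF \<phi> \<psi>) \<longleftrightarrow> fo_sat f v \<phi> \<and> fo_sat f v \<psi>"
| "fo_sat f v (NotF \<phi>) \<longleftrightarrow> \<not> fo_sat f v \<phi>"
| "fo_sat f v (ExF z \<phi>) \<longleftrightarrow> (\<exists>a. fo_sat f (v(z := a)) \<phi>)"

text \<open>
  Subtraction is not part of the term language. The expression x + k, for an integer k, is
  only allowed as a bound in the shorthands x + k \<le> z and z < x + k; when k is negative, the
  summand is moved to the other side, so x - N \<le> z becomes x \<le> z + N. Since < is the only
  order symbol, s \<le> t stands for the negation of t < s.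
\<close>

datatype bound = Offset (bound_var: nat) int

definition plus_nat :: "nat \<Rightarrow> nat \<Rightarrow> trm" where
  "plus_nat x k = (Plus1 ^^ k) (Var x)"

fun bound_le :: "bound \<Rightarrow> nat \<Rightarrow> 'p fo" where
  "bound_le (Offset x k) z = NotF (Less (plus_nat z (nat (- k))) (plus_nat x (nat k)))"

fun less_bound :: "nat \<Rightarrow> bound \<Rightarrow> 'p fo" where
  "less_bound z (Offset x k) = Less (plus_nat z (nat (- k))) (plus_nat x (nat k))"

definition between :: "bound \<Rightarrow> nat \<Rightarrow> bound \<Rightarrow> 'p fo" where
  "between t1 z t2 = AndF (bound_le t1 z) (less_bound z t2)"

text \<open>
  The set B collects the variables bound by the quantifiers enclosing the current subformula.
  The variables of the bounds t1 and t2 must never be captured: otherwise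
  x - N \<le> x < x + N would hold trivially and the quantifier would not be relativised at all.
\<close>

primrec bet_under :: "bound \<Rightarrow> bound \<Rightarrow> nat set \<Rightarrow> 'p fo \<Rightarrow> bool" where
  "bet_under t1 t2 B TrueF \<longleftrightarrow> True"
| "bet_under t1 t2 B (Pred p t) \<longleftrightarrow> (\<exists>y\<in>B. t = Var y)"
| "bet_under t1 t2 B (Less s t) \<longleftrightarrow> True"
| "bet_under t1 t2 B (AndF \<phi> \<psi>) \<longleftrightarrow> bet_under t1 t2 B \<phi> \<and> bet_under t1 t2 B \<psi>"
| "bet_under t1 t2 B (NotF \<phi>) \<longleftrightarrow> bet_under t1 t2 B \<phi>"
| "bet_under t1 t2 B (ExF z \<psi>) \<longleftrightarrow>
     z \<noteq> bound_var t1 \<and> z \<noteq> bound_var t2 \<and> (\<exists>\<chi>. \<psi> = AndF (between t1 z t2) \<chi>) \<and>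
     bet_under t1 t2 (insert z B) \<psi>"

definition Bet :: "bound \<Rightarrow> bound \<Rightarrow> 'p fo set" where
  "Bet t1 t2 = {\<phi>. bet_under t1 t2 {} \<phi>}"

definition N_bounded :: "nat \<Rightarrow> nat \<Rightarrow> 'p fo \<Rightarrow> bool" where
  "N_bounded N x \<phi> \<longleftrightarrow>
     fo_free \<phi> \<subseteq> {x} \<and> \<phi> \<in> Bet (Offset x (- int N)) (Offset x (int N))"

datatype 'p mtl =
    TrueM
  | Prop 'p
  | AndM "'p mtl" "'p mtl"
  | NotM "'p mtl"
  | Until "'p mtl" "real set" "'p mtl"
  | Since "'p mtl" "real set" "'p mtl"

definition mtl_interval :: "real set \<Rightarrow> bool" where
  "mtl_interval I \<longleftrightarrow> I \<noteq> {} \<and> I \<subseteq> {0<..} \<and>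
     (\<exists>a\<in>\<rat>. 0 \<le> a \<and>
        (I \<in> {{a<..}, {a..}} \<or>
         (\<exists>b\<in>\<rat>. 0 \<le> b \<and> I \<in> {{a<..<b}, {a..<b}, {a<..b}, {a..b}})))"

text \<open>
  The raw datatype admits arbitrary sets of reals as constraints; the MTL formulas over P are
  the members of the following set.
\<close>

inductive_set mtl_formulas :: "'p set \<Rightarrow> 'p mtl set" for P where
  "TrueM \<in> mtl_formulas P"
| "p \<in> P \<Longrightarrow> Prop p \<in> mtl_formulas P"
| "\<phi> \<in> mtl_formulas P \<Longrightarrow> \<psi> \<in> mtl_formulas P \<Longrightarrow> AndM \<phi> \<psi> \<in> mtl_formulas P"
| "\<phi> \<in> mtl_formulas P \<Longrightarrow> NotM \<phi> \<in> mtl_formulas P"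
| "\<phi> \<in> mtl_formulas P \<Longrightarrow> mtl_interval I \<Longrightarrow> \<psi> \<in> mtl_formulas P \<Longrightarrow> Until \<phi> I \<psi> \<in> mtl_formulas P"
| "\<phi> \<in> mtl_formulas P \<Longrightarrow> mtl_interval I \<Longrightarrow> \<psi> \<in> mtl_formulas P \<Longrightarrow> Since \<phi> I \<psi> \<in> mtl_formulas P"

primrec mtl_sat :: "(real \<Rightarrow> 'p set) \<Rightarrow> real \<Rightarrow> 'p mtl \<Rightarrow> bool" where
  "mtl_sat f r TrueM \<longleftrightarrow> True"
| "mtl_sat f r (Prop p) \<longleftrightarrow> p \<in> f r"
| "mtl_sat f r (AndM \<phi> \<psi>) \<longleftrightarrow> mtl_sat f r \<phi> \<and> mtl_sat f r \<psi>"
| "mtl_sat f r (NotM \<phi>) \<longleftrightarrow> \<not> mtl_sat f r \<phi>"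
| "mtl_sat f r (Until \<phi> I \<psi>) \<longleftrightarrow>
     (\<exists>t>r. t - r \<in> I \<and> mtl_sat f t \<psi> \<and> (\<forall>u. r < u \<and> u < t \<longrightarrow> mtl_sat f u \<phi>))"
| "mtl_sat f r (Since \<phi> I \<psi>) \<longleftrightarrow>
     (\<exists>t<r. r - t \<in> I \<and> mtl_sat f t \<psi> \<and> (\<forall>u. t < u \<and> u < r \<longrightarrow> mtl_sat f u \<phi>))"

end

theory Submission
  imports Defs
begin

text \<open>
  Reduce every variable modulo 1 to the unit interval [x, x + 1): a quantifier over [x - N, x + N)
  becomes a disjunction over integer shifts, shifted predicates are definable by punctual
  operators, and what remains is a formula of the monadic theory of order. It is decomposed into
  relations between neighbouring points, each a disjunction of chains: a chain between a and b asks
  for a < z1 < ... < zn < b with prescribed conditions at the points and on the gaps. As in Kamp's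
  theorem, the main step is that the complement of a chain is again a disjunction of chains with
  definable conditions; by Dedekind completeness one cuts at the first point where the first gap
  condition fails, at the last point where the last gap condition fails, or at the first point
  where a chain can start. Finally, a chain over an interval of fixed rational length is expressed
  by cutting the interval into short pieces.
\<close>

section \<open>Definable predicates\<close>

text \<open>Signals are arbitrary functions without finite variability, so the points satisfying a
  condition need not have a first one. Each cut therefore has an attained and a limit version, the
  latter recognised by what holds just to the right or left of a point. The obstacle in
  complementing a chain is that two ways of cutting it do not shorten it: the whole chain may lie to
  the right of the cut, or to the left. Failure points of the first and of the last gap condition
  are chosen because they exclude these two cases. Where both conditions hold throughout, the two
  end gaps impose nothing, and only then does the earliest starting point decide, since an earlier
  chain can be rerouted along a later one that ends before b. The same rerouting makes unrestricted
  until harmless, although it looks past b. Lengths matter only for the integer shifts and at the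
  very end. There, nested untils bound each step from the previous point and not from r, so they do
  not confine a whole chain to (r, r + q); short pieces leave enough slack that neither end is
  overrun.\<close>

type_synonym 'p pred = "(real \<Rightarrow> 'p set) \<Rightarrow> real \<Rightarrow> bool"

type_synonym 'p rel = "(real \<Rightarrow> 'p set) \<Rightarrow> real \<Rightarrow> real \<Rightarrow> bool"

text \<open>Equality of functions of f and r makes one formula serve all signals and points
  uniformly, and lets equivalent predicates be exchanged by rewriting.\<close>

definition definable :: "'p set \<Rightarrow> 'p pred \<Rightarrow> bool" where
  "definable P X \<longleftrightarrow> (\<exists>\<phi>\<in>mtl_formulas P. X = (\<lambda>f r. mtl_sat f r \<phi>))"

lemma definable_const [simp, intro]: "definable P (\<lambda>f r. c)"
proof (cases c)
  case True
  have "TrueM \<in> mtl_formulas P" by (rule mtl_formulas.intros)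
  then show ?thesis using True unfolding definable_def by (intro bexI[of _ TrueM]) auto
next
  case False
  have "NotM TrueM \<in> mtl_formulas P" by (intro mtl_formulas.intros)
  then show ?thesis using False unfolding definable_def by (intro bexI[of _ "NotM TrueM"]) auto
qed

lemma definable_prop: "p \<in> P \<Longrightarrow> definable P (\<lambda>f r. p \<in> f r)"
  unfolding definable_def by (intro bexI[of _ "Prop p"]) (auto intro: mtl_formulas.intros)

lemma definable_not [intro]: "definable P X \<Longrightarrow> definable P (\<lambda>f r. \<not> X f r)"
  unfolding definable_def
proof (elim bexE)
  fix \<phi> assume "\<phi> \<in> mtl_formulas P" "X = (\<lambda>f r. mtl_sat f r \<phi>)"
  then show "\<exists>\<phi>\<in>mtl_formulas P. (\<lambda>f r. \<not> X f r) = (\<lambda>f r. mtl_sat f r \<phi>)"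
    by (intro bexI[of _ "NotM \<phi>"]) (auto intro: mtl_formulas.intros)
qed

lemma definable_conj [intro]:
  "definable P X \<Longrightarrow> definable P Y \<Longrightarrow> definable P (\<lambda>f r. X f r \<and> Y f r)"
  unfolding definable_def
proof (elim bexE)
  fix \<phi> \<psi> assume "\<phi> \<in> mtl_formulas P" "X = (\<lambda>f r. mtl_sat f r \<phi>)"
    "\<psi> \<in> mtl_formulas P" "Y = (\<lambda>f r. mtl_sat f r \<psi>)"
  then show "\<exists>\<phi>\<in>mtl_formulas P. (\<lambda>f r. X f r \<and> Y f r) = (\<lambda>f r. mtl_sat f r \<phi>)"
    by (intro bexI[of _ "AndM \<phi> \<psi>"]) (auto intro: mtl_formulas.intros)
qed

lemma definable_disj [intro]:
  assumes "definable P X" "definable P Y"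
  shows "definable P (\<lambda>f r. X f r \<or> Y f r)"
  using definable_not[OF definable_conj[OF definable_not[OF assms(1)] definable_not[OF assms(2)]]]
  by simp

lemma definable_Bex:
  "finite A \<Longrightarrow> (\<And>i. i \<in> A \<Longrightarrow> definable P (X i)) \<Longrightarrow> definable P (\<lambda>f r. \<exists>i\<in>A. X i f r)"
  by (induction A rule: finite_induct) auto

lemma definable_until_interval:
  assumes "definable P X" "definable P Y" "mtl_interval I"
  shows "definable P (\<lambda>f r. \<exists>t>r. t - r \<in> I \<and> Y f t \<and> (\<forall>u\<in>{r<..<t}. X f u))"
proof -
  obtain \<phi> \<psi> where "\<phi> \<in> mtl_formulas P" "X = (\<lambda>f r. mtl_sat f r \<phi>)"
    "\<psi> \<in> mtl_formulas P" "Y = (\<lambda>f r. mtl_sat f r \<psi>)"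
    using assms unfolding definable_def by blast
  then show ?thesis
    unfolding definable_def using assms(3)
    by (intro bexI[of _ "Until \<phi> I \<psi>"]) (auto simp: Ball_def intro: mtl_formulas.intros)
qed

lemma definable_since_interval:
  assumes "definable P X" "definable P Y" "mtl_interval I"
  shows "definable P (\<lambda>f r. \<exists>t<r. r - t \<in> I \<and> Y f t \<and> (\<forall>u\<in>{t<..<r}. X f u))"
proof -
  obtain \<phi> \<psi> where "\<phi> \<in> mtl_formulas P" "X = (\<lambda>f r. mtl_sat f r \<phi>)"
    "\<psi> \<in> mtl_formulas P" "Y = (\<lambda>f r. mtl_sat f r \<psi>)"
    using assms unfolding definable_def by blast
  then show ?thesis
    unfolding definable_def using assms(3)
    by (intro bexI[of _ "Since \<phi> I \<psi>"]) (auto simp: Ball_def intro: mtl_formulas.intros)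
qed

lemma mtl_interval_pos: "mtl_interval {0<..}"
  unfolding mtl_interval_def
  by (intro conjI bexI[of _ 0] disjI1) (auto simp: set_eq_iff intro: exI[of _ 1])

lemma mtl_interval_bounded: "c \<in> \<rat> \<Longrightarrow> 0 < c \<Longrightarrow> mtl_interval {0<..<c}"
  unfolding mtl_interval_def
  by (intro conjI bexI[of _ 0] disjI2 bexI[of _ c]) auto

lemma mtl_interval_point: "c \<in> \<rat> \<Longrightarrow> 0 < c \<Longrightarrow> mtl_interval {c..c}"
  unfolding mtl_interval_def
  by (intro conjI bexI[of _ c] disjI2) auto

lemma definable_until:
  assumes "definable P X" "definable P Y"
  shows "definable P (\<lambda>f r. \<exists>t>r. Y f t \<and> (\<forall>u\<in>{r<..<t}. X f u))"
  using definable_until_interval[OF assms mtl_interval_pos] by simp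

lemma definable_since:
  assumes "definable P X" "definable P Y"
  shows "definable P (\<lambda>f r. \<exists>t<r. Y f t \<and> (\<forall>u\<in>{t<..<r}. X f u))"
  using definable_since_interval[OF assms mtl_interval_pos] by simp

lemma definable_until_within:
  assumes "definable P X" "definable P Y" "c \<in> \<rat>" "0 < c"
  shows "definable P (\<lambda>f r. \<exists>t\<in>{r<..<r + c}. Y f t \<and> (\<forall>u\<in>{r<..<t}. X f u))"
proof -
  have "(\<lambda>f r. \<exists>t\<in>{r<..<r + c}. Y f t \<and> (\<forall>u\<in>{r<..<t}. X f u)) =
    (\<lambda>f r. \<exists>t>r. t - r \<in> {0<..<c} \<and> Y f t \<and> (\<forall>u\<in>{r<..<t}. X f u))"
    by (auto simp: fun_eq_iff algebra_simps Bex_def)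
  then show ?thesis
    using definable_until_interval[OF assms(1,2) mtl_interval_bounded[OF assms(3,4)]] by simp
qed

lemma definable_since_within:
  assumes "definable P X" "definable P Y" "c \<in> \<rat>" "0 < c"
  shows "definable P (\<lambda>f r. \<exists>t\<in>{r - c<..<r}. Y f t \<and> (\<forall>u\<in>{t<..<r}. X f u))"
proof -
  have "(\<lambda>f r. \<exists>t\<in>{r - c<..<r}. Y f t \<and> (\<forall>u\<in>{t<..<r}. X f u)) =
    (\<lambda>f r. \<exists>t<r. r - t \<in> {0<..<c} \<and> Y f t \<and> (\<forall>u\<in>{t<..<r}. X f u))"
    by (auto simp: fun_eq_iff algebra_simps Bex_def)
  then show ?thesis
    using definable_since_interval[OF assms(1,2) mtl_interval_bounded[OF assms(3,4)]] by simp
qed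

lemma definable_shift:
  assumes "definable P X" "c \<in> \<rat>"
  shows "definable P (\<lambda>f r. X f (r + c))"
proof -
  consider "c = 0" | "c > 0" | "c < 0" by linarith
  then show ?thesis
  proof cases
    case 1
    then show ?thesis using assms by simp
  next
    case 2
    have "(\<lambda>f r. X f (r + c)) =
      (\<lambda>f r. \<exists>t>r. t - r \<in> {c..c} \<and> X f t \<and> (\<forall>u\<in>{r<..<t}. True))"
      using 2 by (auto simp: fun_eq_iff algebra_simps)
    then show ?thesis
      using definable_until_interval[OF definable_const assms(1) mtl_interval_point[OF assms(2) 2],
          of True] by simp
  next
    case 3
    then have "- c > 0" "- c \<in> \<rat>" using assms by auto
    have "(\<lambda>f r. X f (r + c)) =
      (\<lambda>f r. \<exists>t<r. r - t \<in> {-c..-c} \<and> X f t \<and> (\<forall>u\<in>{t<..<r}. True))"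
    proof (intro ext iffI)
      fix f r assume "X f (r + c)"
      then show "\<exists>t<r. r - t \<in> {-c..-c} \<and> X f t \<and> (\<forall>u\<in>{t<..<r}. True)"
        using 3 by (intro exI[of _ "r + c"]) auto
    next
      fix f r assume "\<exists>t<r. r - t \<in> {-c..-c} \<and> X f t \<and> (\<forall>u\<in>{t<..<r}. True)"
      then obtain t where "r - t = - c" "X f t" by auto
      moreover from this have "t = r + c" by linarith
      ultimately show "X f (r + c)" by simp
    qed
    then show ?thesis
      using definable_since_interval[OF definable_const assms(1)
          mtl_interval_point[OF \<open>- c \<in> \<rat>\<close> \<open>- c > 0\<close>], of True] by simp
  qed
qed

lemma definable_throughout:
  assumes "definable P X" "c \<in> \<rat>"
  shows "definable P (\<lambda>f r. \<forall>u\<in>{r<..<r + c}. X f u)"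
proof (cases "c > 0")
  case True
  show ?thesis
    using definable_not[OF definable_until_within[OF definable_const definable_not[OF assms(1)]
          assms(2) True, of True]] by simp
qed simp

section \<open>Chains\<close>

text \<open>
  In a chain, the pair (\<beta>, \<alpha>) stands for a gap satisfying \<beta> followed by a point satisfying \<alpha>; the
  gap after the last point satisfies \<gamma>.
\<close>

primrec chain :: "('p pred \<times> 'p pred) list \<Rightarrow> 'p pred \<Rightarrow> 'p rel" where
  "chain [] \<gamma> f a b \<longleftrightarrow> (\<forall>u\<in>{a<..<b}. \<gamma> f u)"
| "chain (p # w) \<gamma> f a b \<longleftrightarrow>
     (\<exists>z\<in>{a<..<b}. (\<forall>u\<in>{a<..<z}. fst p f u) \<and> snd p f z \<and> chain w \<gamma> f z b)"

definition definable_list :: "'p set \<Rightarrow> ('p pred \<times> 'p pred) list \<Rightarrow> bool" where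
  "definable_list P w \<longleftrightarrow> (\<forall>p\<in>set w. definable P (fst p) \<and> definable P (snd p))"

lemma definable_list_simps [simp]:
  "definable_list P []"
  "definable_list P (p # w) \<longleftrightarrow> definable P (fst p) \<and> definable P (snd p) \<and> definable_list P w"
  "definable_list P (v @ w) \<longleftrightarrow> definable_list P v \<and> definable_list P w"
  by (auto simp: definable_list_def)

lemma chain_append:
  "chain (v @ p # w) \<gamma> f a b \<longleftrightarrow>
    (\<exists>z\<in>{a<..<b}. chain v (fst p) f a z \<and> snd p f z \<and> chain w \<gamma> f z b)"
proof (induction v arbitrary: a)
  case (Cons q v)
  show ?case
  proof
    assume "chain ((q # v) @ p # w) \<gamma> f a b"
    then obtain y where y: "y \<in> {a<..<b}" "\<forall>u\<in>{a<..<y}. fst q f u" "snd q f y"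
      and "chain (v @ p # w) \<gamma> f y b" by auto
    then obtain z where "z\<in>{y<..<b}" "chain v (fst p) f y z" "snd p f z" "chain w \<gamma> f z b"
      using Cons.IH by blast
    with y show "\<exists>z\<in>{a<..<b}. chain (q # v) (fst p) f a z \<and> snd p f z \<and> chain w \<gamma> f z b"
      by (intro bexI[of _ z]) auto
  next
    assume "\<exists>z\<in>{a<..<b}. chain (q # v) (fst p) f a z \<and> snd p f z \<and> chain w \<gamma> f z b"
    then obtain z y where z: "z\<in>{a<..<b}" "snd p f z" "chain w \<gamma> f z b"
      and y: "y \<in> {a<..<z}" "\<forall>u\<in>{a<..<y}. fst q f u" "snd q f y" "chain v (fst p) f y z" by auto
    then have "chain (v @ p # w) \<gamma> f y b" unfolding Cons.IH by auto
    with z y show "chain ((q # v) @ p # w) \<gamma> f a b"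
      by (auto intro!: bexI[of _ y])
  qed
qed auto

lemma chain_extend_left:
  assumes "chain (p # w) \<gamma> f d b" "a \<le> d" "\<forall>u\<in>{a<..d}. fst p f u"
  shows "chain (p # w) \<gamma> f a b"
proof -
  obtain z where z: "z \<in> {d<..<b}" "\<forall>u\<in>{d<..<z}. fst p f u" "snd p f z" "chain w \<gamma> f z b"
    using assms by auto
  have "\<forall>u\<in>{a<..<z}. fst p f u"
    using z(2) assms(3) by (metis greaterThanAtMost_iff greaterThanLessThan_iff not_le)
  with z assms(2) show ?thesis by (auto intro!: bexI[of _ z])
qed

lemma chain_extend_right:
  assumes "chain w \<gamma> f a d" "d \<le> b" "\<forall>u\<in>{d..<b}. \<gamma> f u"
  shows "chain w \<gamma> f a b"
  using assms(1)
proof (induction w arbitrary: a)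
  case Nil
  have "\<gamma> f u" if "u \<in> {a<..<b}" for u
    using Nil assms(3) that by (cases "u < d") auto
  then show ?case by simp
next
  case (Cons p w)
  then show ?case using assms(2) by fastforce
qed

section \<open>Cutting a chain at an inner point\<close>

text \<open>
  An element (u, \<delta>, X, v) describes one way of cutting a chain at a point d: u, with last gap \<delta>, to
  the left of d, X at d, and v to the right.
\<close>

fun splits :: "('p pred \<times> 'p pred) list \<Rightarrow> 'p pred \<Rightarrow>
    (('p pred \<times> 'p pred) list \<times> 'p pred \<times> 'p pred \<times> ('p pred \<times> 'p pred) list) set" where
  "splits [] \<gamma> = {([], \<gamma>, \<gamma>, [])}"
| "splits (p # w) \<gamma> = {([], fst p, fst p, p # w), ([], fst p, snd p, w)} \<union>
     (\<lambda>(u, \<delta>, X, v). (p # u, \<delta>, X, v)) ` splits w \<gamma>"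

lemma finite_splits [simp]: "finite (splits w \<gamma>)"
  by (induction w) auto

lemma chain_split:
  assumes "a < d" "d < b"
  shows "chain w \<gamma> f a b \<longleftrightarrow>
    (\<exists>(u, \<delta>, X, v)\<in>splits w \<gamma>. chain u \<delta> f a d \<and> X f d \<and> chain v \<gamma> f d b)"
  using assms(1)
proof (induction w arbitrary: a)
  case Nil
  have "(\<forall>u\<in>{a<..<b}. \<gamma> f u) \<longleftrightarrow>
      (\<forall>u\<in>{a<..<d}. \<gamma> f u) \<and> \<gamma> f d \<and> (\<forall>u\<in>{d<..<b}. \<gamma> f u)"
    using Nil assms(2) by (force intro: linorder_cases[of _ d])
  then show ?case by simp
next
  case (Cons p w)
  show ?case
  proof
    assume "chain (p # w) \<gamma> f a b"
    then obtain z where z: "z \<in> {a<..<b}" "\<forall>u\<in>{a<..<z}. fst p f u" "snd p f z" "chain w \<gamma> f z b"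
      by auto
    consider "d < z" | "d = z" | "z < d" by linarith
    then show "\<exists>(u, \<delta>, X, v)\<in>splits (p # w) \<gamma>. chain u \<delta> f a d \<and> X f d \<and> chain v \<gamma> f d b"
    proof cases
      case 1
      then have "chain [] (fst p) f a d \<and> fst p f d \<and> chain (p # w) \<gamma> f d b"
        using z Cons.prems by (auto intro!: bexI[of _ z])
      then show ?thesis by (intro bexI[of _ "([], fst p, fst p, p # w)"]) simp_all
    next
      case 2
      then have "chain [] (fst p) f a d \<and> snd p f d \<and> chain w \<gamma> f d b"
        using z by auto
      then show ?thesis by (intro bexI[of _ "([], fst p, snd p, w)"]) simp_all
    next
      case 3
      then obtain u \<delta> X v where s: "(u, \<delta>, X, v) \<in> splits w \<gamma>"
        "chain u \<delta> f z d" "X f d" "chain v \<gamma> f d b"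
        using Cons.IH[of z] z(4) by blast
      moreover have "chain (p # u) \<delta> f a d" using s z 3 by auto
      moreover have "(p # u, \<delta>, X, v) \<in> splits (p # w) \<gamma>"
        using s(1) by (auto intro!: image_eqI[of _ _ "(u, \<delta>, X, v)"])
      ultimately show ?thesis by blast
    qed
  next
    assume "\<exists>(u, \<delta>, X, v)\<in>splits (p # w) \<gamma>. chain u \<delta> f a d \<and> X f d \<and> chain v \<gamma> f d b"
    then consider "chain [] (fst p) f a d" "fst p f d" "chain (p # w) \<gamma> f d b"
      | "chain [] (fst p) f a d" "snd p f d" "chain w \<gamma> f d b"
      | u \<delta> X v where "(u, \<delta>, X, v) \<in> splits w \<gamma>" "chain (p # u) \<delta> f a d" "X f d" "chain v \<gamma> f d b"
      by auto
    then show "chain (p # w) \<gamma> f a b"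
    proof cases
      case 1
      then show ?thesis using Cons.prems
        by (intro chain_extend_left[of p w \<gamma> f d b a]) (auto simp: le_less)
    next
      case 2
      then show ?thesis using Cons.prems assms(2) by (auto intro!: bexI[of _ d])
    next
      case 3
      then obtain z where z: "z \<in> {a<..<d}" "\<forall>u\<in>{a<..<z}. fst p f u" "snd p f z" "chain u \<delta> f z d"
        by auto
      then have "chain w \<gamma> f z b" using Cons.IH[of z] 3 by auto
      with z assms(2) show ?thesis by (auto intro!: bexI[of _ z])
    qed
  qed
qed

lemma splits_length:
  "(u, \<delta>, X, v) \<in> splits w \<gamma> \<Longrightarrow> length u + length v \<le> length w"
  by (induction w arbitrary: u) auto

text \<open>This is what permits induction on the length. Only two cuts fail to shorten both sides:
  the cut falls into the first gap, and the whole chain remains on the right, or into the last gap,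
  and it remains on the left.\<close>

lemma splits_cases:
  assumes "(u, \<delta>, X, v) \<in> splits (p # w) \<gamma>"
  obtains "length u < length (p # w)" "length v < length (p # w)"
  | "u = []" "\<delta> = fst p" "X = fst p" "v = p # w"
  | "u = p # w" "\<delta> = \<gamma>" "X = \<gamma>" "v = []"
proof -
  have all_left: "u = w \<and> \<delta> = \<gamma> \<and> X = \<gamma> \<and> v = []" if "(u, \<delta>, X, v) \<in> splits w \<gamma>" "length u \<ge> length w"
    for u \<delta> X v w
    using that
  proof (induction w arbitrary: u)
    case (Cons q w)
    then have "u \<noteq> []" by auto
    then obtain u' where "u = q # u'" "(u', \<delta>, X, v) \<in> splits w \<gamma>" using Cons.prems by auto
    then show ?case using Cons by auto
  qed auto
  have len: "length u + length v \<le> length (p # w)" using splits_length[OF assms] .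
  show thesis
  proof (cases "length v < length (p # w)")
    case True
    then show ?thesis using that(1,3) all_left[OF assms] by (cases "length u < length (p # w)") auto
  next
    case False
    then have "u = []" using len by (cases u) auto
    then have "(v = p # w \<and> \<delta> = fst p \<and> X = fst p) \<or> v = w" using assms by auto
    then show ?thesis using that(2) \<open>u = []\<close> False by auto
  qed
qed

lemma definable_splits:
  assumes "(u, \<delta>, X, v) \<in> splits w \<gamma>" "definable_list P w" "definable P \<gamma>"
  shows "definable_list P u" "definable P \<delta>" "definable P X" "definable_list P v"
  using assms by (induction w arbitrary: u) auto

section \<open>Interval relations\<close>

text \<open>Finite disjunctions of chains with unary conditions at both ends. The rule
  \<open>cong\<close> identifies relations that agree for \<open>a < b\<close>, the only pairs that
  matter. Composition, conjunction and complement are deliberately not rules: closure under them is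
  the content of what follows.\<close>

inductive intdef :: "'p set \<Rightarrow> 'p rel \<Rightarrow> bool" for P where
  base: "definable P A \<Longrightarrow> definable P B \<Longrightarrow> definable_list P w \<Longrightarrow> definable P \<gamma> \<Longrightarrow>
    intdef P (\<lambda>f a b. A f a \<and> B f b \<and> chain w \<gamma> f a b)"
| disj: "intdef P R \<Longrightarrow> intdef P R' \<Longrightarrow> intdef P (\<lambda>f a b. R f a b \<or> R' f a b)"
| cong: "intdef P R \<Longrightarrow> (\<And>f a b. a < b \<Longrightarrow> R' f a b \<longleftrightarrow> R f a b) \<Longrightarrow> intdef P R'"

lemma intdef_chain:
  "definable_list P w \<Longrightarrow> definable P \<gamma> \<Longrightarrow> intdef P (chain w \<gamma>)"
  using intdef.base[of P "\<lambda>_ _. True" "\<lambda>_ _. True"] by simp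

lemma intdef_throughout:
  "definable P X \<Longrightarrow> intdef P (\<lambda>f a b. \<forall>u\<in>{a<..<b}. X f u)"
  by (rule intdef.cong[OF intdef_chain[of P "[]" X]]) auto

lemma intdef_endpoints:
  "definable P A \<Longrightarrow> definable P B \<Longrightarrow> intdef P (\<lambda>f a b. A f a \<and> B f b)"
  by (rule intdef.cong[OF intdef.base[of P A B "[]" "\<lambda>_ _. True"]]) auto

lemma intdef_left: "definable P A \<Longrightarrow> intdef P (\<lambda>f a b. A f a)"
  by (rule intdef.cong[OF intdef_endpoints[of P A "\<lambda>_ _. True"]]) auto

lemma intdef_right: "definable P B \<Longrightarrow> intdef P (\<lambda>f a b. B f b)"
  by (rule intdef.cong[OF intdef_endpoints[of P "\<lambda>_ _. True" B]]) auto

lemma intdef_const: "intdef P (\<lambda>f a b. c)"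
  by (rule intdef.cong[OF intdef_left[of P "\<lambda>_ _. c"]]) auto

text \<open>Two chains meeting at c concatenate to one: the right end condition of the first and the
  left end condition of the second together become the point condition at c. This is how an
  existential quantifier over a point between two neighbours is eliminated.\<close>

lemma intdef_comp:
  assumes "intdef P R" "intdef P R'"
  shows "intdef P (\<lambda>f a b. \<exists>c\<in>{a<..<b}. R f a c \<and> R' f c b)"
  using assms
proof (induction R rule: intdef.induct)
  case (base A B w \<gamma>)
  from base(5) show ?case
  proof (induction R' rule: intdef.induct)
    case (base A' B' w' \<gamma>')
    have "intdef P (\<lambda>f a b. A f a \<and> B' f b \<and> chain (w @ (\<gamma>, \<lambda>f u. B f u \<and> A' f u) # w') \<gamma>' f a b)"
      using base \<open>definable P A\<close> \<open>definable P B\<close> \<open>definable P \<gamma>\<close> \<open>definable_list P w\<close>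
      by (intro intdef.base) auto
    then show ?case by (rule intdef.cong) (auto simp: chain_append)
  next
    case (disj R1 R2)
    show ?case by (rule intdef.cong[OF intdef.disj[OF disj.IH]]) auto
  next
    case (cong R1 R2)
    show ?case using cong.hyps by (intro intdef.cong[OF cong.IH]) auto
  qed
next
  case (disj R1 R2)
  show ?case by (rule intdef.cong[OF intdef.disj[OF disj.IH[OF disj.prems]]]) auto
next
  case (cong R1 R2)
  show ?case using cong.hyps by (intro intdef.cong[OF cong.IH[OF cong.prems]]) auto
qed

section \<open>Closure under conjunction\<close>

lemma intdef_conj_left:
  assumes "intdef P R" "definable P X"
  shows "intdef P (\<lambda>f a b. X f a \<and> R f a b)"
  using assms(1)
proof (induction R rule: intdef.induct)
  case (base A B w \<gamma>)
  then have "intdef P (\<lambda>f a b. (X f a \<and> A f a) \<and> B f b \<and> chain w \<gamma> f a b)"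
    using assms(2) by (intro intdef.base) auto
  then show ?case by (rule intdef.cong) auto
next
  case (disj R1 R2)
  show ?case by (rule intdef.cong[OF intdef.disj[OF disj.IH]]) auto
next
  case (cong R1 R2)
  show ?case using cong.hyps by (intro intdef.cong[OF cong.IH]) auto
qed

lemma intdef_conj_right:
  assumes "intdef P R" "definable P X"
  shows "intdef P (\<lambda>f a b. X f b \<and> R f a b)"
  using assms(1)
proof (induction R rule: intdef.induct)
  case (base A B w \<gamma>)
  then have "intdef P (\<lambda>f a b. A f a \<and> (X f b \<and> B f b) \<and> chain w \<gamma> f a b)"
    using assms(2) by (intro intdef.base) auto
  then show ?case by (rule intdef.cong) auto
next
  case (disj R1 R2)
  show ?case by (rule intdef.cong[OF intdef.disj[OF disj.IH]]) auto
next
  case (cong R1 R2)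
  show ?case using cong.hyps by (intro intdef.cong[OF cong.IH]) auto
qed

lemma intdef_Cons:
  assumes "definable P X" "definable P Y" "intdef P R"
  shows "intdef P (\<lambda>f a b. \<exists>z\<in>{a<..<b}. (\<forall>u\<in>{a<..<z}. X f u) \<and> Y f z \<and> R f z b)"
  using intdef_comp[OF intdef_throughout[OF assms(1)] intdef_conj_left[OF assms(3,2)]] .

text \<open>Shuffling two chains: look at the earlier of their first points. The other chain is then
  still inside its first gap, or has its first point at the same place, which gives the three
  alternatives.\<close>

lemma chain_Cons_conj:
  "chain (p # w) \<gamma> f a b \<and> chain (p' # w') \<gamma>' f a b \<longleftrightarrow>
    (\<exists>z\<in>{a<..<b}. (\<forall>u\<in>{a<..<z}. fst p f u \<and> fst p' f u) \<and>
        (snd p f z \<and> fst p' f z \<and> chain w \<gamma> f z b \<and> chain (p' # w') \<gamma>' f z b \<or>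
         fst p f z \<and> snd p' f z \<and> chain (p # w) \<gamma> f z b \<and> chain w' \<gamma>' f z b \<or>
         snd p f z \<and> snd p' f z \<and> chain w \<gamma> f z b \<and> chain w' \<gamma>' f z b))"
    (is "?l = ?r")
proof
  assume ?l
  then obtain z z' where z: "z\<in>{a<..<b}" "\<forall>u\<in>{a<..<z}. fst p f u" "snd p f z" "chain w \<gamma> f z b"
    and z': "z'\<in>{a<..<b}" "\<forall>u\<in>{a<..<z'}. fst p' f u" "snd p' f z'" "chain w' \<gamma>' f z' b"
    by auto
  consider "z < z'" | "z' < z" | "z = z'" by linarith
  then show ?r
  proof cases
    case 1
    then have "chain (p' # w') \<gamma>' f z b" using z z' by (auto intro!: bexI[of _ z'])
    then show ?thesis using z z' 1 by (intro bexI[of _ z]) auto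
  next
    case 2
    then have "chain (p # w) \<gamma> f z' b" using z z' by (auto intro!: bexI[of _ z])
    then show ?thesis using z z' 2 by (intro bexI[of _ z']) auto
  next
    case 3
    then show ?thesis using z z' by (intro bexI[of _ z]) auto
  qed
next
  assume ?r
  then obtain z where z: "z\<in>{a<..<b}" "\<forall>u\<in>{a<..<z}. fst p f u \<and> fst p' f u"
    and "(snd p f z \<and> fst p' f z \<and> chain w \<gamma> f z b \<and> chain (p' # w') \<gamma>' f z b \<or>
         fst p f z \<and> snd p' f z \<and> chain (p # w) \<gamma> f z b \<and> chain w' \<gamma>' f z b \<or>
         snd p f z \<and> snd p' f z \<and> chain w \<gamma> f z b \<and> chain w' \<gamma>' f z b)" by blast
  then consider "snd p f z" "fst p' f z" "chain w \<gamma> f z b" "chain (p' # w') \<gamma>' f z b"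
    | "fst p f z" "snd p' f z" "chain (p # w) \<gamma> f z b" "chain w' \<gamma>' f z b"
    | "snd p f z" "snd p' f z" "chain w \<gamma> f z b" "chain w' \<gamma>' f z b" by blast
  then show ?l
  proof cases
    case 1
    then have "chain (p' # w') \<gamma>' f a b"
      using z by (intro chain_extend_left[of p' w' \<gamma>' f z b a]) (auto simp: le_less)
    then show ?thesis using z 1 by auto
  next
    case 2
    then have "chain (p # w) \<gamma> f a b"
      using z by (intro chain_extend_left[of p w \<gamma> f z b a]) (auto simp: le_less)
    then show ?thesis using z 2 by auto
  next
    case 3
    then show ?thesis using z by auto
  qed
qed

lemma intdef_chain_throughout:
  assumes "definable_list P w" "definable P \<gamma>" "definable P \<delta>"
  shows "intdef P (\<lambda>f a b. chain w \<gamma> f a b \<and> (\<forall>u\<in>{a<..<b}. \<delta> f u))"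
  using assms(1)
proof (induction w)
  case Nil
  have "intdef P (\<lambda>f a b. \<forall>u\<in>{a<..<b}. \<gamma> f u \<and> \<delta> f u)"
    using assms by (intro intdef_throughout) auto
  then show ?case by (rule intdef.cong) auto
next
  case (Cons p w)
  then have "intdef P (\<lambda>f a b. \<exists>z\<in>{a<..<b}. (\<forall>u\<in>{a<..<z}. fst p f u \<and> \<delta> f u) \<and>
      (snd p f z \<and> \<delta> f z) \<and> chain w \<gamma> f z b \<and> (\<forall>u\<in>{z<..<b}. \<delta> f u))"
    using assms by (intro intdef_Cons) auto
  moreover have "chain (p # w) \<gamma> f a b \<and> (\<forall>u\<in>{a<..<b}. \<delta> f u) \<longleftrightarrow>
      (\<exists>z\<in>{a<..<b}. (\<forall>u\<in>{a<..<z}. fst p f u \<and> \<delta> f u) \<and>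
      (snd p f z \<and> \<delta> f z) \<and> chain w \<gamma> f z b \<and> (\<forall>u\<in>{z<..<b}. \<delta> f u))" (is "?l \<longleftrightarrow> ?r") for f a b
  proof
    assume ?r
    then obtain z where z: "z\<in>{a<..<b}" "\<forall>u\<in>{a<..<z}. fst p f u \<and> \<delta> f u" "snd p f z" "\<delta> f z"
      "chain w \<gamma> f z b" "\<forall>u\<in>{z<..<b}. \<delta> f u" by blast
    moreover have "\<delta> f u" if "u \<in> {a<..<b}" for u
      using z that by (cases u z rule: linorder_cases) auto
    ultimately show ?l by auto
  qed force
  ultimately show ?case by simp
qed

text \<open>Each alternative of the shuffle shortens at least one of the two lists, hence the nested
  induction. A chain without points is a condition on the whole interval and has been treated
  separately.\<close>

lemma intdef_chain_conj:
  assumes "definable_list P w" "definable P \<gamma>" "definable_list P w'" "definable P \<gamma>'"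
  shows "intdef P (\<lambda>f a b. chain w \<gamma> f a b \<and> chain w' \<gamma>' f a b)"
  using assms(1,3)
proof (induction w arbitrary: w')
  case Nil
  then have "intdef P (\<lambda>f a b. chain w' \<gamma>' f a b \<and> (\<forall>u\<in>{a<..<b}. \<gamma> f u))"
    using assms by (intro intdef_chain_throughout) auto
  then show ?case by (rule intdef.cong) auto
next
  case (Cons p w)
  note outer = Cons.IH
  from \<open>definable_list P w'\<close> show ?case
  proof (induction w')
    case Nil
    then have "intdef P (\<lambda>f a b. chain (p # w) \<gamma> f a b \<and> (\<forall>u\<in>{a<..<b}. \<gamma>' f u))"
      using assms Cons.prems by (intro intdef_chain_throughout) auto
    then show ?case by (rule intdef.cong) auto
  next
    case (Cons p' w')
    let ?Q = "\<lambda>v v' f a b. chain v \<gamma> f a b \<and> chain v' \<gamma>' f a b"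
    have def: "definable P (fst p)" "definable P (snd p)" "definable_list P w"
      "definable P (fst p')" "definable P (snd p')" "definable_list P w'"
      using Cons.prems \<open>definable_list P (p # w)\<close> by auto
    have IH: "intdef P (?Q w (p' # w'))" "intdef P (?Q (p # w) w')" "intdef P (?Q w w')"
      using outer[OF def(3) Cons.prems] outer[OF def(3,6)] Cons.IH[OF def(6)] by blast+
    have "intdef P (\<lambda>f a b. \<exists>z\<in>{a<..<b}. (\<forall>u\<in>{a<..<z}. fst p f u \<and> fst p' f u) \<and> True \<and>
        ((snd p f z \<and> fst p' f z) \<and> ?Q w (p' # w') f z b \<or>
         (fst p f z \<and> snd p' f z) \<and> ?Q (p # w) w' f z b \<or>
         (snd p f z \<and> snd p' f z) \<and> ?Q w w' f z b))"
      using def IH by (intro intdef_Cons intdef.disj intdef_conj_left) auto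
    then show ?case
      by (rule intdef.cong) (simp only: chain_Cons_conj simp_thms conj_assoc)
  qed
qed

lemma intdef_conj:
  assumes "intdef P R" "intdef P R'"
  shows "intdef P (\<lambda>f a b. R f a b \<and> R' f a b)"
  using assms
proof (induction R rule: intdef.induct)
  case (base A B w \<gamma>)
  from base(5) show ?case
  proof (induction R' rule: intdef.induct)
    case (base A' B' w' \<gamma>')
    have "intdef P (\<lambda>f a b. (A f a \<and> A' f a) \<and> (B f b \<and> B' f b) \<and>
        chain w \<gamma> f a b \<and> chain w' \<gamma>' f a b)"
      using base \<open>definable P A\<close> \<open>definable P B\<close> \<open>definable P \<gamma>\<close> \<open>definable_list P w\<close>
      by (intro intdef_conj_left intdef_conj_right intdef_chain_conj) auto
    then show ?case by (rule intdef.cong) auto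
  next
    case (disj R1 R2)
    show ?case by (rule intdef.cong[OF intdef.disj[OF disj.IH]]) auto
  next
    case (cong R1 R2)
    show ?case using cong.hyps by (intro intdef.cong[OF cong.IH]) auto
  qed
next
  case (disj R1 R2)
  show ?case by (rule intdef.cong[OF intdef.disj[OF disj.IH[OF disj.prems]]]) auto
next
  case (cong R1 R2)
  show ?case using cong.hyps by (intro intdef.cong[OF cong.IH[OF cong.prems]]) auto
qed

text \<open>A finite conjunction of disjunctions is distributed over the two sides of the cut point.\<close>

lemma intdef_comp_conj:
  assumes "finite S" "intdef P L" "intdef P R"
    and "\<And>s. s \<in> S \<Longrightarrow> intdef P (A s)" "\<And>s. s \<in> S \<Longrightarrow> intdef P (B s)"
  shows "intdef P (\<lambda>f a b. \<exists>c\<in>{a<..<b}. L f a c \<and> (\<forall>s\<in>S. A s f a c \<or> B s f c b) \<and> R f c b)"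
  using assms
proof (induction S arbitrary: L R rule: finite_induct)
  case empty
  then show ?case by (simp add: intdef_comp)
next
  case (insert s S)
  have "intdef P (\<lambda>f a b.
      (\<exists>c\<in>{a<..<b}. (L f a c \<and> A s f a c) \<and> (\<forall>s\<in>S. A s f a c \<or> B s f c b) \<and> R f c b) \<or>
      (\<exists>c\<in>{a<..<b}. L f a c \<and> (\<forall>s\<in>S. A s f a c \<or> B s f c b) \<and> (R f c b \<and> B s f c b)))"
    using insert.prems by (intro intdef.disj insert.IH intdef_conj) auto
  then show ?case by (rule intdef.cong) auto
qed

section \<open>Complements of chains\<close>

definition holds_right :: "'p pred \<Rightarrow> 'p pred" where
  "holds_right X f a \<longleftrightarrow> (\<exists>t>a. \<forall>u\<in>{a<..<t}. X f u)"

definition holds_left :: "'p pred \<Rightarrow> 'p pred" where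
  "holds_left X f b \<longleftrightarrow> (\<exists>t<b. \<forall>u\<in>{t<..<b}. X f u)"

lemma definable_holds_right: "definable P X \<Longrightarrow> definable P (holds_right X)"
  using definable_until[of P X "\<lambda>_ _. True"] by (simp add: holds_right_def[abs_def])

lemma definable_holds_left: "definable P X \<Longrightarrow> definable P (holds_left X)"
  using definable_since[of P X "\<lambda>_ _. True"] by (simp add: holds_left_def[abs_def])

text \<open>Nested unrestricted untils: the unary, hence definable, part of a chain, with the right
  end forgotten.\<close>

primrec reach :: "('p pred \<times> 'p pred) list \<Rightarrow> 'p pred" where
  "reach [] f a \<longleftrightarrow> True"
| "reach (p # w) f a \<longleftrightarrow> (\<exists>z>a. (snd p f z \<and> reach w f z) \<and> (\<forall>u\<in>{a<..<z}. fst p f u))"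

lemma definable_reach: "definable_list P w \<Longrightarrow> definable P (reach w)"
proof (induction w)
  case (Cons p w)
  then have "definable P (\<lambda>f a. \<exists>z>a. (snd p f z \<and> reach w f z) \<and> (\<forall>u\<in>{a<..<z}. fst p f u))"
    by (intro definable_until) auto
  then show ?case by (simp add: fun_eq_iff[symmetric] reach.simps(2)[abs_def])
next
  case Nil
  have "reach [] = (\<lambda>_ _. True)" by (simp add: fun_eq_iff)
  then show ?case by simp
qed

abbreviation ptrue :: "'p pred" where
  "ptrue \<equiv> \<lambda>_ _. True"

lemma chain_imp_reach: "chain w \<gamma> f a b \<Longrightarrow> reach w f a"
proof (induction w arbitrary: a)
  case (Cons p w)
  then obtain z where "z\<in>{a<..<b}" "\<forall>u\<in>{a<..<z}. fst p f u" "snd p f z" "chain w \<gamma> f z b" by auto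
  then show ?case using Cons.IH by auto
qed simp

lemma chain_mono:
  assumes "chain w \<gamma> f a b" "\<And>u. u \<in> {a<..<b} \<Longrightarrow> \<gamma> f u \<Longrightarrow> \<delta> f u"
  shows "chain w \<delta> f a b"
  using assms
proof (induction w arbitrary: a)
  case (Cons p w)
  then obtain z where "z\<in>{a<..<b}" "\<forall>u\<in>{a<..<z}. fst p f u" "snd p f z" "chain w \<gamma> f z b" by auto
  moreover from this have "chain w \<delta> f z b" by (intro Cons.IH Cons.prems(2)) auto
  ultimately show ?case by auto
qed auto

text \<open>
  Follow the chain starting at the left point y until it is overtaken by the chain starting at y';
  from then on continue with the latter, which is known to end before b.
\<close>

lemma chain_crossing:
  assumes "reach w f y" "chain w ptrue f y' b" "y \<le> y'"
  shows "chain w ptrue f y b"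
  using assms
proof (induction w arbitrary: y y')
  case (Cons p w)
  obtain t where t: "t > y" "snd p f t" "reach w f t" "\<forall>u\<in>{y<..<t}. fst p f u"
    using Cons.prems(1) by auto
  obtain t' where t': "t' \<in> {y'<..<b}" "\<forall>u\<in>{y'<..<t'}. fst p f u" "snd p f t'" "chain w ptrue f t' b"
    using Cons.prems(2) by auto
  show ?case
  proof (cases "t \<le> t'")
    case True
    then have "chain w ptrue f t b" using Cons.IH t(3) t'(4) by blast
    then show ?thesis using True t t' by (auto intro!: bexI[of _ t])
  next
    case False
    then show ?thesis using t t' Cons.prems(3) by (auto intro!: bexI[of _ t'])
  qed
qed simp

text \<open>What remains to be required at a limit of starting points. Elements whose gap condition
  fails arbitrarily close to the right of a are stripped, because their points can be squeezed
  towards a. If nothing survives, the points fit before any b, hence the value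
  \<open>True\<close>.\<close>

primrec limit_chain :: "('p pred \<times> 'p pred) list \<Rightarrow> 'p rel" where
  "limit_chain [] f a b \<longleftrightarrow> True"
| "limit_chain (p # w) f a b \<longleftrightarrow>
    (if holds_right (fst p) f a then chain (p # w) ptrue f a b else limit_chain w f a b)"

text \<open>
  If the starting points of chains accumulate at y from the right, then so do their first
  points, second points and so on, up to the first gap condition that holds to the right of y.
\<close>

lemma free_chain_iff_limit_chain:
  assumes "y < b"
    and "\<And>e. e > y \<Longrightarrow> \<exists>z\<in>{y<..<e}. X f z \<and> reach w f z"
  shows "(\<exists>z\<in>{y<..<b}. X f z \<and> chain w ptrue f z b) \<longleftrightarrow> limit_chain w f y b"
  using assms(2)
proof (induction w arbitrary: X)
  case Nil
  then show ?case using assms(1) by auto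
next
  case (Cons p w)
  show ?case
  proof (cases "holds_right (fst p) f y")
    case True
    then obtain e where e: "e > y" "\<forall>u\<in>{y<..<e}. fst p f u" unfolding holds_right_def by blast
    have "(\<exists>z\<in>{y<..<b}. X f z \<and> chain (p # w) ptrue f z b) \<longleftrightarrow> chain (p # w) ptrue f y b"
    proof
      assume "\<exists>z\<in>{y<..<b}. X f z \<and> chain (p # w) ptrue f z b"
      then obtain z where z: "z\<in>{y<..<b}" "X f z" "chain (p # w) ptrue f z b" by blast
      \<comment> \<open>Below \<open>z\<close>, so that the chain from \<open>z'\<close> can be
        rerouted along the one from \<open>z\<close>; below \<open>e\<close>, so that the first gap
        can be extended back to \<open>y\<close>.\<close>
      then obtain z' where z': "z' \<in> {y<..<min z e}" "reach (p # w) f z'"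
        using Cons.prems[of "min z e"] e(1) z(1) by (meson greaterThanLessThan_iff min_less_iff_conj)
      then have "chain (p # w) ptrue f z' b"
        using chain_crossing[OF z'(2) z(3)] by simp
      then show "chain (p # w) ptrue f y b"
        using z' e(2) by (intro chain_extend_left[of p w ptrue f z' b y]) auto
    next
      assume "chain (p # w) ptrue f y b"
      then obtain t where t: "t\<in>{y<..<b}" "\<forall>u\<in>{y<..<t}. fst p f u" "snd p f t" "chain w ptrue f t b"
        by auto
      then obtain z where "z \<in> {y<..<t}" "X f z" using Cons.prems[of t] by auto
      with t show "\<exists>z\<in>{y<..<b}. X f z \<and> chain (p # w) ptrue f z b"
        by (intro bexI[of _ z]) (auto intro!: bexI[of _ t])
    qed
    then show ?thesis using True by simp
  next
    case False
    \<comment> \<open>A failure \<open>q\<close> of the gap condition close to \<open>y\<close> acts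
      as a barrier: the first gap of a chain starting before \<open>q\<close> cannot pass it, so its
      first point is close to \<open>y\<close> as well.\<close>
    have small: "\<exists>z t. y < z \<and> z < t \<and> t < e \<and> X f z \<and> (\<forall>u\<in>{z<..<t}. fst p f u) \<and> snd p f t \<and> reach w f t"
      if e: "e > y" for e
    proof -
      obtain q where q: "q \<in> {y<..<e}" "\<not> fst p f q"
        using False e unfolding holds_right_def by blast
      have "q > y" using q(1) by simp
      then obtain z where z: "z \<in> {y<..<q}" "X f z" "reach (p # w) f z"
        using Cons.prems[of q] by blast
      then obtain t where t: "t > z" "snd p f t" "reach w f t" "\<forall>u\<in>{z<..<t}. fst p f u" by auto
      then have "t \<le> q" using q(2) z(1) by (metis greaterThanLessThan_iff not_le)
      then show ?thesis using q(1) z t by (intro exI[of _ z] exI[of _ t]) auto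
    qed
    have "(\<exists>z\<in>{y<..<b}. snd p f z \<and> chain w ptrue f z b) \<longleftrightarrow> limit_chain w f y b"
    proof (rule Cons.IH)
      fix e assume "e > y"
      then show "\<exists>z\<in>{y<..<e}. snd p f z \<and> reach w f z" using small[of e] by force
    qed
    moreover have "(\<exists>z\<in>{y<..<b}. X f z \<and> chain (p # w) ptrue f z b) \<longleftrightarrow>
      (\<exists>z\<in>{y<..<b}. snd p f z \<and> chain w ptrue f z b)"
    proof
      assume "\<exists>z\<in>{y<..<b}. snd p f z \<and> chain w ptrue f z b"
      then obtain t where t: "t\<in>{y<..<b}" "snd p f t" "chain w ptrue f t b" by blast
      obtain z t' where z: "y < z" "z < t'" "t' < t" "X f z" "\<forall>u\<in>{z<..<t'}. fst p f u" "snd p f t'"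
          "reach w f t'"
        using small[of t] t(1) by auto
      then have "chain w ptrue f t' b" using chain_crossing[of w f t' t b] t(3) by simp
      then show "\<exists>z\<in>{y<..<b}. X f z \<and> chain (p # w) ptrue f z b"
        using z t(1) by (intro bexI[of _ z]) (auto intro!: bexI[of _ t'])
    qed force
    ultimately show ?thesis using False by simp
  qed
qed

text \<open>Take the infimum of the points of F in (a, b): either it is such a point, or such points
  accumulate at it from the right. In the second case it may be a itself, hence the half-open
  range.\<close>

lemma first_point:
  fixes a b :: real
  assumes "z \<in> {a<..<b}" "F z"
  obtains (attained) y where "y \<in> {a<..<b}" "\<forall>u\<in>{a<..<y}. \<not> F u" "F y"
  | (limit) y where "y \<in> {a..<b}" "\<forall>u\<in>{a<..y}. \<not> F u" "\<And>e. e > y \<Longrightarrow> \<exists>z\<in>{y<..<e}. F z"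
proof -
  define A where "A = {z\<in>{a<..<b}. F z}"
  define y where "y = Inf A"
  have A: "A \<noteq> {}" "bdd_below A" "z \<in> A" using assms by (auto simp: A_def bdd_below_def intro: less_imp_le)
  have "y \<le> z" using A y_def cInf_lower by metis
  have "a \<le> y" unfolding y_def using A(1) by (intro cInf_greatest) (auto simp: A_def)
  have before: "\<not> F u" if "u \<in> {a<..<y}" for u
  proof
    assume "F u"
    then have "u \<in> A" using that \<open>y \<le> z\<close> assms(1) by (auto simp: A_def)
    then have "y \<le> u" unfolding y_def using A(2) by (rule cInf_lower)
    then show False using that by simp
  qed
  show thesis
  proof (cases "y \<in> A")
    case True
    then show ?thesis using before by (intro attained[of y]) (auto simp: A_def)
  next
    case False
    have "\<exists>z\<in>{y<..<e}. F z" if e: "e > y" for e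
    proof -
      obtain x where "x \<in> A" "x < e" using cInf_lessD[OF A(1), of e] e unfolding y_def by blast
      moreover from this have "y \<le> x" unfolding y_def using A(2) by (intro cInf_lower)
      ultimately show ?thesis using False by (cases "x = y") (auto simp: A_def)
    qed
    moreover have "y \<in> {a..<b}" using \<open>a \<le> y\<close> \<open>y \<le> z\<close> assms(1) by auto
    moreover have "\<forall>u\<in>{a<..y}. \<not> F u"
      using before False calculation(2) by (auto simp: A_def le_less)
    ultimately show ?thesis by (intro limit[of y])
  qed
qed

text \<open>A limit chain is a case distinction, by definable conditions at a, between chains for
  the suffixes of w, so complements for lists up to that length are enough.\<close>

lemma intdef_not_limit_chain:
  assumes "definable_list P w"
    and "\<And>v. length v \<le> length w \<Longrightarrow> definable_list P v \<Longrightarrow> intdef P (\<lambda>f a b. \<not> chain v ptrue f a b)"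
  shows "intdef P (\<lambda>f a b. \<not> limit_chain w f a b)"
  using assms
proof (induction w)
  case Nil
  then show ?case by (simp add: intdef_const)
next
  case (Cons p w)
  have "intdef P (\<lambda>f a b. \<not> chain (p # w) ptrue f a b)" using Cons.prems by blast
  moreover have "intdef P (\<lambda>f a b. \<not> limit_chain w f a b)" using Cons by auto
  ultimately have "intdef P (\<lambda>f a b. holds_right (fst p) f a \<and> \<not> chain (p # w) ptrue f a b \<or>
    \<not> holds_right (fst p) f a \<and> \<not> limit_chain w f a b)"
    using Cons.prems by (intro intdef.disj intdef_conj_left definable_not definable_holds_right) auto
  then show ?case by (rule intdef.cong) auto
qed

text \<open>With no condition before the first point and none after the last, only the earliest
  candidate matters. Candidates are the points F from which the chain can be continued somewhere,
  possibly past b; if any of them leads to a chain ending before b, then so does each earlier one.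
  If there is no earliest candidate, the limit chain at their infimum takes its place.\<close>

lemma intdef_not_free_chain:
  assumes "definable P X" "definable_list P w"
    and IH: "\<And>v. length v \<le> length w \<Longrightarrow> definable_list P v \<Longrightarrow> intdef P (\<lambda>f a b. \<not> chain v ptrue f a b)"
  shows "intdef P (\<lambda>f a b. \<not> (\<exists>z\<in>{a<..<b}. X f z \<and> chain w ptrue f z b))"
proof -
  define F where "F = (\<lambda>f z. X f z \<and> reach w f z)"
  define acc where "acc = (\<lambda>f y. \<not> holds_right (\<lambda>f u. \<not> F f u) f y)"
  have F: "definable P F" unfolding F_def using assms definable_reach by blast
  have acc: "definable P acc" unfolding acc_def using F definable_holds_right by blast
  have acc_iff: "acc f y \<longleftrightarrow> (\<forall>e>y. \<exists>z\<in>{y<..<e}. F f z)" for f y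
    unfolding acc_def holds_right_def by auto
  \<comment> \<open>The alternatives: no candidate at all; a first candidate that does not finish
    before b; candidates accumulating at an inner point y; candidates accumulating at a
    itself.\<close>
  have "intdef P (\<lambda>f a b. (\<forall>u\<in>{a<..<b}. \<not> F f u) \<or>
    (\<exists>y\<in>{a<..<b}. (\<forall>u\<in>{a<..<y}. \<not> F f u) \<and> F f y \<and> \<not> chain w ptrue f y b) \<or>
    (\<exists>y\<in>{a<..<b}. (\<forall>u\<in>{a<..<y}. \<not> F f u) \<and> (\<not> F f y \<and> acc f y) \<and> \<not> limit_chain w f y b) \<or>
    acc f a \<and> \<not> limit_chain w f a b)"
    using F acc assms
    by (intro intdef.disj intdef_throughout intdef_Cons intdef_conj_left intdef_not_limit_chain) auto
  then show ?thesis
  proof (rule intdef.cong)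
    fix f and a b :: real assume "a < b"
    have attained: "(\<exists>z\<in>{a<..<b}. X f z \<and> chain w ptrue f z b) \<longleftrightarrow> chain w ptrue f y b"
      if y: "y \<in> {a<..<b}" "\<forall>u\<in>{a<..<y}. \<not> F f u" "F f y" for y
    proof
      assume "\<exists>z\<in>{a<..<b}. X f z \<and> chain w ptrue f z b"
      then obtain z where z: "z \<in> {a<..<b}" "X f z" "chain w ptrue f z b" by blast
      then have "F f z" unfolding F_def using chain_imp_reach by blast
      then have "y \<le> z" using y(2) z(1) by (meson greaterThanLessThan_iff not_le)
      then show "chain w ptrue f y b" using chain_crossing[OF _ z(3)] y(3) by (simp add: F_def)
    qed (use y in \<open>auto simp: F_def\<close>)
    have limit: "(\<exists>z\<in>{a<..<b}. X f z \<and> chain w ptrue f z b) \<longleftrightarrow> limit_chain w f y b"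
      if y: "y \<in> {a..<b}" "\<forall>u\<in>{a<..y}. \<not> F f u" "acc f y" for y
    proof -
      have "(\<exists>z\<in>{a<..<b}. X f z \<and> chain w ptrue f z b) \<longleftrightarrow> (\<exists>z\<in>{y<..<b}. X f z \<and> chain w ptrue f z b)"
      proof
        assume "\<exists>z\<in>{a<..<b}. X f z \<and> chain w ptrue f z b"
        then obtain z where z: "z \<in> {a<..<b}" "X f z" "chain w ptrue f z b" by blast
        then have "F f z" unfolding F_def using chain_imp_reach by blast
        then have "y < z" using y(2) z(1) by (meson greaterThanAtMost_iff greaterThanLessThan_iff not_le)
        then show "\<exists>z\<in>{y<..<b}. X f z \<and> chain w ptrue f z b" using z by auto
      qed (use y in auto)
      also have "\<dots> \<longleftrightarrow> limit_chain w f y b"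
        using y(1,3) by (intro free_chain_iff_limit_chain) (auto simp: acc_iff F_def)
      finally show ?thesis .
    qed
    show "\<not> (\<exists>z\<in>{a<..<b}. X f z \<and> chain w ptrue f z b) \<longleftrightarrow>
      (\<forall>u\<in>{a<..<b}. \<not> F f u) \<or>
      (\<exists>y\<in>{a<..<b}. (\<forall>u\<in>{a<..<y}. \<not> F f u) \<and> F f y \<and> \<not> chain w ptrue f y b) \<or>
      (\<exists>y\<in>{a<..<b}. (\<forall>u\<in>{a<..<y}. \<not> F f u) \<and> (\<not> F f y \<and> acc f y) \<and> \<not> limit_chain w f y b) \<or>
      acc f a \<and> \<not> limit_chain w f a b" (is "\<not> ?free \<longleftrightarrow> ?none \<or> ?att \<or> ?lim \<or> ?start")
    proof
      assume "\<not> ?free"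
      show "?none \<or> ?att \<or> ?lim \<or> ?start"
      proof (cases ?none)
        case False
        then obtain z where "z \<in> {a<..<b}" "F f z" by blast
        then show ?thesis
        proof (cases rule: first_point)
          case (attained y)
          then have ?att using \<open>\<not> ?free\<close> \<open>\<And>y. _ \<Longrightarrow> _ \<Longrightarrow> F f y \<Longrightarrow> ?free \<longleftrightarrow> _\<close> by blast
          then show ?thesis by blast
        next
          case (limit y)
          then have "acc f y" unfolding acc_iff by blast
          then have "\<not> limit_chain w f y b"
            using \<open>\<not> ?free\<close> \<open>\<And>y. _ \<Longrightarrow> _ \<Longrightarrow> acc f y \<Longrightarrow> ?free \<longleftrightarrow> _\<close> limit by blast
          then have ?start if "y = a" using that \<open>acc f y\<close> by blast
          moreover have ?lim if "y \<noteq> a"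
            using that \<open>acc f y\<close> \<open>\<not> limit_chain w f y b\<close> limit(1,2)
            by (intro bexI[of _ y]) auto
          ultimately show ?thesis by blast
        qed
      qed blast
    next
      assume "?none \<or> ?att \<or> ?lim \<or> ?start"
      then consider ?none | ?att | ?lim | ?start by blast
      then show "\<not> ?free"
      proof cases
        case 1
        then show ?thesis unfolding F_def using chain_imp_reach by blast
      next
        case 2
        then show ?thesis using attained by blast
      next
        case 3
        then obtain y where "y \<in> {a<..<b}" "\<forall>u\<in>{a<..<y}. \<not> F f u" "\<not> F f y" "acc f y"
          "\<not> limit_chain w f y b" by blast
        moreover from this have "\<forall>u\<in>{a<..y}. \<not> F f u" by (auto simp: le_less)
        ultimately show ?thesis using limit[of y] by auto
      next
        case 4
        then show ?thesis using limit[of a] \<open>a < b\<close> by simp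
      qed
    qed
  qed
qed

section \<open>Cut points and complements of arbitrary chains\<close>

lemma chain_imp_holds_left: "a < b \<Longrightarrow> chain w \<gamma> f a b \<Longrightarrow> holds_left \<gamma> f b"
  by (induction w arbitrary: a) (auto simp: holds_left_def)

lemma chain_imp_holds_right: "chain (p # w) \<gamma> f a b \<Longrightarrow> holds_right (fst p) f a"
  by (auto simp: holds_right_def)

text \<open>The point c is as far as a gap with condition X starting at a can extend: X fails at c
  or at points accumulating at c from the right. Hence no such gap contains c and no such gap starts
  at c with X true there as well.\<close>

lemma first_failure:
  assumes "holds_right X f a" "\<not> (\<forall>u\<in>{a<..<b}. X f u)"
  obtains c where "c \<in> {a<..<b}" "\<forall>u\<in>{a<..<c}. X f u" "\<not> X f c \<or> \<not> holds_right X f c"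
proof -
  obtain z where z: "z \<in> {a<..<b}" "\<not> X f z" using assms(2) by blast
  then show thesis
  proof (cases rule: first_point[where F = "\<lambda>u. \<not> X f u"])
    case (attained y)
    then show ?thesis using that by blast
  next
    case (limit y)
    have "\<not> holds_right X f y" unfolding holds_right_def using limit(3) by blast
    moreover from this have "y \<noteq> a" using assms(1) by blast
    ultimately show ?thesis using limit by (intro that[of y]) auto
  qed
qed

lemma last_failure:
  assumes "holds_left X f b" "\<not> (\<forall>u\<in>{a<..<b}. X f u)"
  obtains c where "c \<in> {a<..<b}" "\<forall>u\<in>{c<..<b}. X f u" "\<not> X f c \<or> \<not> holds_left X f c"
proof -
  \<comment> \<open>Reflection at 0 is applied to the predicate only, not to the signal, so
    \<open>first_failure\<close> can be reused.\<close>
  let ?Y = "\<lambda>f u. X f (- u)"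
  have mirror: "(\<forall>u\<in>{- d<..<- c}. X f (- u)) \<longleftrightarrow> (\<forall>u\<in>{c<..<d}. X f u)" for c d :: real
    by (metis add.inverse_inverse greaterThanLessThan_iff neg_less_iff_less)
  have holds: "holds_right ?Y f (- c) \<longleftrightarrow> holds_left X f c" for c
  proof
    assume "holds_right ?Y f (- c)"
    then obtain t where "t > - c" "\<forall>u\<in>{- c<..<- (- t)}. X f (- u)" unfolding holds_right_def by auto
    then show "holds_left X f c"
      unfolding holds_left_def mirror by (intro exI[of _ "- t"]) auto
  next
    assume "holds_left X f c"
    then obtain t where "t < c" "\<forall>u\<in>{- c<..<- t}. X f (- u)" unfolding holds_left_def mirror by blast
    then show "holds_right ?Y f (- c)" unfolding holds_right_def by (intro exI[of _ "- t"]) auto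
  qed
  have "holds_right ?Y f (- b)" "\<not> (\<forall>u\<in>{- b<..<- a}. ?Y f u)"
    using assms unfolding holds mirror by auto
  then obtain c where "c \<in> {- b<..<- a}" "\<forall>u\<in>{- b<..<c}. ?Y f u"
    "\<not> ?Y f c \<or> \<not> holds_right ?Y f c"
    by (rule first_failure)
  then show thesis using mirror[of b "- c"] holds[of "- c"] by (intro that[of "- c"]) auto
qed

text \<open>Induction on the length, with two nested cuts. At the first failure of the first gap
  condition the chain cannot lie wholly to the right; what is left over is the same chain on an
  interval where that condition holds. There the last failure of the final gap condition excludes
  the chain lying wholly to the left, and the leftover is a chain with both end conditions
  automatic, that is, a free chain for the shorter list \<open>w'\<close>.\<close>

lemma intdef_not_chain:
  assumes "definable_list P w" "definable P \<gamma>"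
  shows "intdef P (\<lambda>f a b. \<not> chain w \<gamma> f a b)"
  using assms
proof (induction w arbitrary: \<gamma> rule: length_induct)
  case (1 w)
  have IH: "intdef P (\<lambda>f a b. \<not> chain v \<delta> f a b)"
    if "length v < length w" "definable_list P v" "definable P \<delta>" for v \<delta>
    using 1 that by blast
  show ?case
  proof (cases w)
    case Nil
    have "intdef P (chain [(ptrue, \<lambda>f u. \<not> \<gamma> f u)] ptrue)"
      using "1.prems" by (intro intdef_chain) auto
    then show ?thesis by (rule intdef.cong) (auto simp: Nil)
  next
    case (Cons p w')
    define \<beta> \<alpha> where "\<beta> = fst p" and "\<alpha> = snd p"
    have def: "definable P \<beta>" "definable P \<alpha>" "definable_list P w'"
      using "1.prems" by (auto simp: Cons \<beta>_def \<alpha>_def)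
    \<comment> \<open>Only the splits that shorten both sides, so that the induction hypothesis
      applies to them. \<open>A\<close> says that the part up to and including the cut point fails,
      \<open>B\<close> that the right part fails; \<open>uncut\<close> then has the conjunctive
      shape required by \<open>intdef_comp_conj\<close>.\<close>
    define S where "S = {s \<in> splits w \<gamma>. case s of (u, \<delta>, X, v) \<Rightarrow> length u < length w \<and> length v < length w}"
    define A B :: "('a pred \<times> 'a pred) list \<times> 'a pred \<times> 'a pred \<times> ('a pred \<times> 'a pred) list \<Rightarrow> 'a rel"
      where "A = (\<lambda>(u, \<delta>, X, v) f a c. \<not> X f c \<or> \<not> chain u \<delta> f a c)"
        and "B = (\<lambda>(u, \<delta>, X, v) f c b. \<not> chain v \<gamma> f c b)"
    define uncut where "uncut = (\<lambda>f a c b. \<forall>s\<in>S. A s f a c \<or> B s f c b)"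
    define nofree :: "'a rel" where
      "nofree = (\<lambda>f a b. \<not> (\<exists>z\<in>{a<..<b}. \<alpha> f z \<and> chain w' ptrue f z b))"
    have [simp]: "finite S" unfolding S_def by simp
    have A: "intdef P (A s)" if "s \<in> S" for s
    proof -
      obtain u \<delta> X v where s: "s = (u, \<delta>, X, v)" by (cases s)
      then have mem: "(u, \<delta>, X, v) \<in> splits w \<gamma>" "length u < length w"
        using that by (auto simp: S_def)
      show ?thesis unfolding s A_def prod.case
        using definable_splits[OF mem(1) "1.prems"] mem(2)
        by (intro intdef.disj IH intdef_right definable_not)
    qed
    have B: "intdef P (B s)" if "s \<in> S" for s
    proof -
      obtain u \<delta> X v where s: "s = (u, \<delta>, X, v)" by (cases s)
      then have mem: "(u, \<delta>, X, v) \<in> splits w \<gamma>" "length v < length w"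
        using that by (auto simp: S_def)
      show ?thesis unfolding s B_def
        using definable_splits[OF mem(1) "1.prems"] mem(2) "1.prems"(2)
        by (auto intro!: IH)
    qed
    have uncut: "intdef P (\<lambda>f a b. \<exists>c\<in>{a<..<b}. L f a c \<and> uncut f a c b \<and> R f c b)"
      if "intdef P L" "intdef P R" for L R
      unfolding uncut_def using that A B by (intro intdef_comp_conj) auto
    have nofree: "intdef P nofree"
      unfolding nofree_def using def IH by (intro intdef_not_free_chain) (auto simp: Cons)

    \<comment> \<open>Valid at every inner point c. The second and third alternatives are the splits
      that do not shorten the chain and so are out of reach of the induction hypothesis; the choice
      of c has to dispose of them.\<close>
    have cut: "chain w \<gamma> f a b \<longleftrightarrow> \<not> uncut f a c b \<or>
        (\<forall>u\<in>{a<..<c}. \<beta> f u) \<and> \<beta> f c \<and> chain w \<gamma> f c b \<or>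
        chain w \<gamma> f a c \<and> \<gamma> f c \<and> (\<forall>u\<in>{c<..<b}. \<gamma> f u)" (is "?l \<longleftrightarrow> ?r")
      if c: "c \<in> {a<..<b}" for f a b c
    proof
      assume ?l
      then obtain u \<delta> X v where s: "(u, \<delta>, X, v) \<in> splits (p # w') \<gamma>"
        "chain u \<delta> f a c" "X f c" "chain v \<gamma> f c b"
        using chain_split[of a c b w \<gamma> f] c unfolding Cons
        by (auto simp del: splits.simps chain.simps)
      from s(1) show ?r
      proof (cases rule: splits_cases)
        case 1
        then have "(u, \<delta>, X, v) \<in> S" using s(1) by (auto simp: S_def Cons)
        moreover have "\<not> (A (u, \<delta>, X, v) f a c \<or> B (u, \<delta>, X, v) f c b)"
          using s by (simp add: A_def B_def)
        ultimately show ?thesis unfolding uncut_def by blast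
      next
        case 2
        then show ?thesis using s by (auto simp: \<beta>_def Cons)
      next
        case 3
        then show ?thesis using s by (auto simp: Cons)
      qed
    next
      assume ?r
      then consider "\<not> uncut f a c b"
        | "\<forall>u\<in>{a<..<c}. \<beta> f u" "\<beta> f c" "chain w \<gamma> f c b"
        | "chain w \<gamma> f a c" "\<gamma> f c" "\<forall>u\<in>{c<..<b}. \<gamma> f u" by blast
      then show ?l
      proof cases
        case 1
        then obtain s where s: "s \<in> S" "\<not> A s f a c" "\<not> B s f c b" unfolding uncut_def by blast
        obtain u \<delta> X v where "s = (u, \<delta>, X, v)" by (cases s)
        with s have "(u, \<delta>, X, v) \<in> splits w \<gamma>" "chain u \<delta> f a c" "X f c" "chain v \<gamma> f c b"
          by (auto simp: S_def A_def B_def)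
        then show ?thesis using chain_split[of a c b w \<gamma> f] c by auto
      next
        case 2
        then show ?thesis unfolding Cons using c
          by (intro chain_extend_left[of p w' \<gamma> f c b a]) (auto simp: \<beta>_def le_less)
      next
        case 3
        then show ?thesis using c
          by (intro chain_extend_right[of w \<gamma> f a c b]) (auto simp: le_less)
      qed
    qed

    \<comment> \<open>The first and last gaps are unconstrained here, so a chain only needs some
      \<alpha>-point followed by \<open>w'\<close> with a trivial last gap.\<close>
    have both: "nofree f a b \<longleftrightarrow> \<not> chain w \<gamma> f a b"
      if "\<forall>u\<in>{a<..<b}. \<beta> f u" "\<forall>u\<in>{a<..<b}. \<gamma> f u" for f a b
    proof -
      have "chain w' ptrue f z b \<longleftrightarrow> chain w' \<gamma> f z b" if "z \<in> {a<..<b}" for z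
        using that \<open>\<forall>u\<in>{a<..<b}. \<gamma> f u\<close> by (auto elim!: chain_mono)
      then show ?thesis using that(1) unfolding nofree_def Cons \<alpha>_def \<beta>_def by fastforce
    qed

    \<comment> \<open>The complement on intervals where \<beta> holds throughout. At a last failure
      c of \<gamma> the third alternative of \<open>cut\<close> is impossible, and the second
      reduces to the chain on (c, b), where \<open>both\<close> applies.\<close>
    define left :: "'a rel" where
      "left = (\<lambda>f a b. (\<forall>u\<in>{a<..<b}. \<gamma> f u) \<and> nofree f a b \<or> \<not> holds_left \<gamma> f b \<or>
         (\<exists>c\<in>{a<..<b}. (\<not> \<gamma> f c \<or> \<not> holds_left \<gamma> f c) \<and> uncut f a c b \<and>
            (\<forall>u\<in>{c<..<b}. \<gamma> f u) \<and> nofree f c b))"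
    have left: "intdef P left" unfolding left_def
      using nofree "1.prems"(2)
      by (intro intdef.disj intdef_conj intdef_throughout intdef_right definable_not
          definable_holds_left definable_disj
          uncut[of "\<lambda>f a c. \<not> \<gamma> f c \<or> \<not> holds_left \<gamma> f c"]) auto
    have left_iff: "left f a b \<longleftrightarrow> \<not> chain w \<gamma> f a b"
      if ab: "a < b" and \<beta>: "\<forall>u\<in>{a<..<b}. \<beta> f u" for f a b
    proof -
      have at_cut: "\<not> chain w \<gamma> f a b \<longleftrightarrow> uncut f a c b \<and> nofree f c b"
        if c: "c \<in> {a<..<b}" "\<not> \<gamma> f c \<or> \<not> holds_left \<gamma> f c" "\<forall>u\<in>{c<..<b}. \<gamma> f u" for c
        using cut[OF c(1), of f] both[of c b f] c \<beta> chain_imp_holds_left[of a c w \<gamma> f] by auto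
      consider "\<forall>u\<in>{a<..<b}. \<gamma> f u" | "\<not> holds_left \<gamma> f b"
        | "holds_left \<gamma> f b" "\<not> (\<forall>u\<in>{a<..<b}. \<gamma> f u)" by blast
      then show ?thesis
      proof cases
        case 1
        have "holds_left \<gamma> f c" "\<gamma> f c" if "c \<in> {a<..<b}" for c
          using 1 that unfolding holds_left_def by (auto intro!: exI[of _ a])
        moreover have "holds_left \<gamma> f b" using 1 ab unfolding holds_left_def by blast
        ultimately show ?thesis using both[OF \<beta> 1] 1 unfolding left_def by blast
      next
        case 2
        then show ?thesis using chain_imp_holds_left[OF ab] unfolding left_def by blast
      next
        case 3
        then obtain c where "c \<in> {a<..<b}" "\<not> \<gamma> f c \<or> \<not> holds_left \<gamma> f c" "\<forall>u\<in>{c<..<b}. \<gamma> f u"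
          using last_failure by blast
        then show ?thesis using at_cut 3 unfolding left_def by blast
      qed
    qed

    \<comment> \<open>At a first failure c of \<beta> the second alternative of \<open>cut\<close>
      is impossible. The third fails either through \<open>left\<close> or \<gamma> at c, or through
      a point beyond c violating \<gamma>; these two possibilities give the last two disjuncts. The
      trivial conjuncts \<open>True\<close> bring the terms into the shape of \<open>uncut\<close>
      and \<open>intdef_Cons\<close>.\<close>
    have "intdef P (\<lambda>f a b. (\<forall>u\<in>{a<..<b}. \<beta> f u) \<and> left f a b \<or> \<not> holds_right \<beta> f a \<or>
      (\<exists>c\<in>{a<..<b}. ((\<forall>u\<in>{a<..<c}. \<beta> f u) \<and> (\<not> \<beta> f c \<or> \<not> holds_right \<beta> f c) \<and>
        (left f a c \<or> \<not> \<gamma> f c)) \<and> uncut f a c b \<and> True) \<or>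
      (\<exists>c\<in>{a<..<b}. ((\<forall>u\<in>{a<..<c}. \<beta> f u) \<and> (\<not> \<beta> f c \<or> \<not> holds_right \<beta> f c)) \<and>
        uncut f a c b \<and> (\<exists>z\<in>{c<..<b}. (\<forall>u\<in>{c<..<z}. True) \<and> \<not> \<gamma> f z \<and> True)))"
      using left "1.prems"(2) def
      by (intro intdef.disj intdef_conj intdef_throughout intdef_left definable_not
          definable_holds_right intdef_Cons definable_disj uncut intdef_const definable_const
          intdef_right[of P "\<lambda>f c. \<not> \<gamma> f c"] intdef_right[of P "\<lambda>f c. \<not> \<beta> f c \<or> \<not> holds_right \<beta> f c"])
    then show ?thesis
    proof (rule intdef.cong)
      fix f and a b :: real assume ab: "a < b"
      have at_cut: "\<not> chain w \<gamma> f a b \<longleftrightarrow>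
          uncut f a c b \<and> (left f a c \<or> \<not> \<gamma> f c \<or> \<not> (\<forall>u\<in>{c<..<b}. \<gamma> f u))"
        if c: "c \<in> {a<..<b}" "\<not> \<beta> f c \<or> \<not> holds_right \<beta> f c" "\<forall>u\<in>{a<..<c}. \<beta> f u" for c
      proof -
        have "\<not> (\<beta> f c \<and> chain w \<gamma> f c b)"
          using c(2) chain_imp_holds_right[of p w' \<gamma> f c b] unfolding Cons \<beta>_def by blast
        moreover have "left f a c \<longleftrightarrow> \<not> chain w \<gamma> f a c" using left_iff[OF _ c(3)] c(1) by simp
        ultimately show ?thesis using cut[OF c(1), of f] by blast
      qed
      consider "\<forall>u\<in>{a<..<b}. \<beta> f u" | "\<not> holds_right \<beta> f a"
        | "holds_right \<beta> f a" "\<not> (\<forall>u\<in>{a<..<b}. \<beta> f u)" by blast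
      then show "\<not> chain w \<gamma> f a b \<longleftrightarrow>
        (\<forall>u\<in>{a<..<b}. \<beta> f u) \<and> left f a b \<or> \<not> holds_right \<beta> f a \<or>
        (\<exists>c\<in>{a<..<b}. ((\<forall>u\<in>{a<..<c}. \<beta> f u) \<and> (\<not> \<beta> f c \<or> \<not> holds_right \<beta> f c) \<and>
          (left f a c \<or> \<not> \<gamma> f c)) \<and> uncut f a c b \<and> True) \<or>
        (\<exists>c\<in>{a<..<b}. ((\<forall>u\<in>{a<..<c}. \<beta> f u) \<and> (\<not> \<beta> f c \<or> \<not> holds_right \<beta> f c)) \<and>
          uncut f a c b \<and> (\<exists>z\<in>{c<..<b}. (\<forall>u\<in>{c<..<z}. True) \<and> \<not> \<gamma> f z \<and> True))"
      proof cases
        case 1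
        have "holds_right \<beta> f c" "\<beta> f c" if "c \<in> {a<..<b}" for c
          using 1 that unfolding holds_right_def by (auto intro!: exI[of _ b])
        moreover have "holds_right \<beta> f a" using 1 ab unfolding holds_right_def by blast
        ultimately show ?thesis using left_iff[OF ab 1] 1 by blast
      next
        case 2
        then show ?thesis using chain_imp_holds_right[of p w' \<gamma> f a b] unfolding Cons \<beta>_def by blast
      next
        case 3
        then obtain c where "c \<in> {a<..<b}" "\<not> \<beta> f c \<or> \<not> holds_right \<beta> f c" "\<forall>u\<in>{a<..<c}. \<beta> f u"
          using first_failure by blast
        then show ?thesis using at_cut 3 by blast
      qed
    qed
  qed
qed

lemma intdef_not: "intdef P R \<Longrightarrow> intdef P (\<lambda>f a b. \<not> R f a b)"
proof (induction R rule: intdef.induct)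
  case (base A B w \<gamma>)
  then have "intdef P (\<lambda>f a b. \<not> A f a \<or> \<not> B f b \<or> \<not> chain w \<gamma> f a b)"
    by (intro intdef.disj intdef_left intdef_right intdef_not_chain definable_not)
  then show ?case by (rule intdef.cong) auto
next
  case (disj R R')
  show ?case by (rule intdef.cong[OF intdef_conj[OF disj.IH]]) auto
next
  case (cong R R')
  show ?case using cong.hyps by (intro intdef.cong[OF cong.IH]) auto
qed

section \<open>Chains over intervals of fixed length\<close>

lemma definable_throughout_half_open:
  assumes "definable P X" "c \<in> \<rat>" "e \<in> \<rat>"
  shows "definable P (\<lambda>f r. \<forall>u\<in>{r + c<..r + e}. X f u)" (is "definable P ?l")
    and "definable P (\<lambda>f r. \<forall>u\<in>{r + c..<r + e}. X f u)" (is "definable P ?r")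
proof -
  have open_def: "definable P (\<lambda>f r. \<forall>u\<in>{r + c<..<r + e}. X f u)"
    using definable_shift[OF definable_throughout[OF assms(1), of "e - c"] assms(2)] assms
    by (simp add: add.assoc)
  show "definable P ?l"
  proof (cases "c < e")
    case True
    then have "?l = (\<lambda>f r. X f (r + e) \<and> (\<forall>u\<in>{r + c<..<r + e}. X f u))"
      by (force simp: fun_eq_iff le_less)
    then show ?thesis using open_def definable_shift[OF assms(1,3)] by auto
  qed simp
  show "definable P ?r"
  proof (cases "c < e")
    case True
    then have "?r = (\<lambda>f r. X f (r + c) \<and> (\<forall>u\<in>{r + c<..<r + e}. X f u))"
      by (force simp: fun_eq_iff le_less)
    then show ?thesis using open_def definable_shift[OF assms(1,2)] by auto
  qed simp
qed

text \<open>
  The next two predicates describe a chain starting at a fixed point, or ending at a fixed point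
  (with the list reversed), all of whose steps are shorter than \<delta>.
\<close>

primrec forward :: "('p pred \<times> 'p pred) list \<Rightarrow> 'p pred \<Rightarrow> real \<Rightarrow> 'p pred" where
  "forward [] \<gamma> \<delta> f a \<longleftrightarrow> (\<forall>u\<in>{a<..<a + \<delta>}. \<gamma> f u)"
| "forward (p # w) \<gamma> \<delta> f a \<longleftrightarrow>
    (\<exists>z\<in>{a<..<a + \<delta>}. (snd p f z \<and> forward w \<gamma> \<delta> f z) \<and> (\<forall>u\<in>{a<..<z}. fst p f u))"

primrec backward :: "('p pred \<times> 'p pred) list \<Rightarrow> 'p pred \<Rightarrow> real \<Rightarrow> 'p pred" where
  "backward [] \<gamma> \<delta> f b \<longleftrightarrow> (\<forall>u\<in>{b - \<delta><..<b}. \<gamma> f u)"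
| "backward (p # w) \<gamma> \<delta> f b \<longleftrightarrow>
    (\<exists>z\<in>{b - \<delta><..<b}. (snd p f z \<and> backward w (fst p) \<delta> f z) \<and> (\<forall>u\<in>{z<..<b}. \<gamma> f u))"

text \<open>Applied to a reversed list, where the gap reached last by \<open>backward\<close> is the
  first gap of the original chain.\<close>

primrec last_gap :: "('p pred \<times> 'p pred) list \<Rightarrow> 'p pred \<Rightarrow> 'p pred" where
  "last_gap [] \<gamma> = \<gamma>"
| "last_gap (p # w) \<gamma> = last_gap w (fst p)"

lemma last_gap_snoc [simp]: "last_gap (w @ [p]) \<gamma> = fst p"
  by (induction w arbitrary: \<gamma>) auto

lemma definable_forward:
  assumes "definable_list P w" "definable P \<gamma>" "\<delta> \<in> \<rat>" "\<delta> > 0"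
  shows "definable P (forward w \<gamma> \<delta>)"
  using assms(1)
proof (induction w)
  case Nil
  then show ?case using definable_throughout[OF assms(2,3)] by (simp add: forward.simps(1)[abs_def])
next
  case (Cons p w)
  then show ?case
    using definable_until_within[of P "fst p" "\<lambda>f z. snd p f z \<and> forward w \<gamma> \<delta> f z" \<delta>] assms(3,4)
    by (auto simp: forward.simps(2)[abs_def])
qed

lemma definable_backward:
  assumes "definable_list P w" "definable P \<gamma>" "\<delta> \<in> \<rat>" "\<delta> > 0"
  shows "definable P (backward w \<gamma> \<delta>)"
  using assms(1,2)
proof (induction w arbitrary: \<gamma>)
  case Nil
  have "definable P (\<lambda>f b. \<not> (\<exists>t\<in>{b - \<delta><..<b}. \<not> \<gamma> f t \<and> (\<forall>u\<in>{t<..<b}. True)))"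
    using Nil assms(3,4) by (intro definable_not definable_since_within) auto
  then show ?case by (simp add: backward.simps(1)[abs_def])
next
  case (Cons p w)
  then show ?case
    using definable_since_within[of P \<gamma> "\<lambda>f z. snd p f z \<and> backward w (fst p) \<delta> f z" \<delta>] assms(3,4)
    by (auto simp: backward.simps(2)[abs_def])
qed

text \<open>Steps shorter than \<delta>, one per element of w, cannot overrun b. The last point z
  satisfies \<open>z \<ge> d\<close>, so the stretch of length \<delta> after it, on which \<gamma>
  is checked, reaches c, where the assumption on \<gamma> takes over.\<close>

lemma forward_imp_chain:
  fixes b c d \<delta> :: real
  assumes "forward w \<gamma> \<delta> f d" "d + length w * \<delta> \<le> b" "\<forall>u\<in>{c..<b}. \<gamma> f u" "c \<le> d + \<delta>" "\<delta> > 0"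
  shows "chain w \<gamma> f d b"
  using assms(1,2,4)
proof (induction w arbitrary: d)
  case Nil
  have "\<gamma> f u" if "u \<in> {d<..<b}" for u
    using Nil that assms(3) by (cases "u < d + \<delta>") auto
  then show ?case by simp
next
  case (Cons p w)
  then obtain z where z: "z \<in> {d<..<d + \<delta>}" "snd p f z" "forward w \<gamma> \<delta> f z" "\<forall>u\<in>{d<..<z}. fst p f u"
    by auto
  have "d + length w * \<delta> + \<delta> \<le> b" using Cons.prems(2) by (simp add: algebra_simps)
  moreover have "length w * \<delta> \<ge> 0" using assms(5) by simp
  ultimately have "z + length w * \<delta> \<le> b" "z < b"
    using z(1) unfolding greaterThanLessThan_iff by linarith+
  moreover from this have "chain w \<gamma> f z b" using z Cons.prems(3) by (intro Cons.IH) auto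
  ultimately show ?case using z by auto
qed

text \<open>Inside a piece of length at most \<delta> all steps are short. The assumption on
  \<gamma> extends to \<open>c + \<delta>\<close> because \<open>forward\<close> inspects a full
  length \<delta> after the last point, which may lie close to c.\<close>

lemma chain_imp_forward:
  assumes "chain w \<gamma> f d c" "d < c" "c \<le> d + \<delta>" "\<forall>u\<in>{c..<c + \<delta>}. \<gamma> f u"
  shows "forward w \<gamma> \<delta> f d"
  using assms(1-3)
proof (induction w arbitrary: d)
  case Nil
  have "\<gamma> f u" if "u \<in> {d<..<d + \<delta>}" for u
    using Nil that assms(4) by (cases "u < c") auto
  then show ?case by simp
next
  case (Cons p w)
  then obtain z where "z \<in> {d<..<c}" "\<forall>u\<in>{d<..<z}. fst p f u" "snd p f z" "chain w \<gamma> f z c" by auto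
  moreover from this have "forward w \<gamma> \<delta> f z" using Cons.prems(3) by (intro Cons.IH) auto
  ultimately show ?case using Cons.prems(3) by (auto intro!: bexI[of _ z])
qed

lemma backward_imp_chain:
  fixes a c d \<delta> :: real
  assumes "backward w \<gamma> \<delta> f d" "a \<le> d - length w * \<delta>" "\<forall>u\<in>{a<..c}. last_gap w \<gamma> f u"
    "d - \<delta> \<le> c" "\<delta> > 0"
  shows "chain (rev w) \<gamma> f a d"
  using assms(1-4)
proof (induction w arbitrary: d \<gamma>)
  case Nil
  have "\<gamma> f u" if "u \<in> {a<..<d}" for u
    using Nil that by (cases "u > d - \<delta>") auto
  then show ?case by simp
next
  case (Cons p w)
  then obtain z where z: "z \<in> {d - \<delta><..<d}" "snd p f z" "backward w (fst p) \<delta> f z"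
      "\<forall>u\<in>{z<..<d}. \<gamma> f u"
    by auto
  have "a \<le> d - length w * \<delta> - \<delta>" using Cons.prems(2) by (simp add: algebra_simps)
  moreover have "length w * \<delta> \<ge> 0" using assms(5) by simp
  ultimately have *: "a \<le> z - length w * \<delta>" "a < z"
    using z(1) unfolding greaterThanLessThan_iff by linarith+
  then have "chain (rev w) (fst p) f a z" using z Cons.prems(3,4) by (intro Cons.IH) auto
  then show ?case using z * by (auto simp: chain_append)
qed

lemma chain_imp_backward:
  assumes "chain (rev w) \<gamma> f c d" "c < d" "d \<le> c + \<delta>" "\<forall>u\<in>{c - \<delta><..c}. last_gap w \<gamma> f u"
  shows "backward w \<gamma> \<delta> f d"
  using assms
proof (induction w arbitrary: d \<gamma>)
  case Nil
  have "\<gamma> f u" if "u \<in> {d - \<delta><..<d}" for u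
    using Nil that by (cases "u > c") auto
  then show ?case by simp
next
  case (Cons p w)
  then obtain z where "z \<in> {c<..<d}" "chain (rev w) (fst p) f c z" "snd p f z" "\<forall>u\<in>{z<..<d}. \<gamma> f u"
    by (auto simp: chain_append)
  moreover from this have "backward w (fst p) \<delta> f z" using Cons.prems(3,4) by (intro Cons.IH) auto
  ultimately show ?case using Cons.prems(3) by (auto intro!: bexI[of _ z])
qed

text \<open>
  Cut the interval into pieces of length \<delta>. If all points of the chain lie in one piece, then
  the chain can be followed with steps shorter than \<delta> from the near end of that piece towards the
  middle of the interval without leaving the interval. Otherwise some cut splits it into shorter chains.
\<close>

lemma definable_chain:
  assumes "definable_list P w" "definable P \<gamma>" "q \<in> \<rat>" "q > 0"
  shows "definable P (\<lambda>f r. chain w \<gamma> f r (r + q))"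
  using assms
proof (induction w arbitrary: \<gamma> q rule: length_induct)
  case (1 w)
  have IH: "definable P (\<lambda>f r. chain v \<delta> f (r + c) (r + e))"
    if "length v < length w" "definable_list P v" "definable P \<delta>" "c \<in> \<rat>" "e \<in> \<rat>" "c < e" for v \<delta> c e
  proof -
    have "definable P (\<lambda>f r. chain v \<delta> f r (r + (e - c)))" using 1(1) that by auto
    then show ?thesis using definable_shift[OF _ that(4)] by (fastforce simp: add.assoc)
  qed
  show ?case
  proof (cases w)
    case Nil
    then show ?thesis using definable_throughout[OF "1.prems"(2,3)] by simp
  next
    case (Cons p w')
    define n where "n = length w"
    \<comment> \<open>From the start of a piece with index \<open>i \<le> n\<close>, n short steps
      stay below \<open>(i + n) * \<delta> \<le> q\<close>; backwards from the end of a later piece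
      they stay above 0. The additional pieces leave room for the length \<delta> inspected beyond
      the last point.\<close>
    define K where "K = 2 * n + 2"
    define \<delta> where "\<delta> = q / K"
    have n: "n \<ge> 1" unfolding n_def Cons by simp
    have \<delta>: "\<delta> \<in> \<rat>" "\<delta> > 0" "K * \<delta> = q" unfolding \<delta>_def K_def using "1.prems" by auto
    define d where "d = (\<lambda>i. real i * \<delta>)"
    have d: "d i \<in> \<rat>" "d i < d (Suc i)" "d 0 = 0" "d K = q" "d (Suc i) = d i + \<delta>" for i
      unfolding d_def using \<delta> by (auto simp: algebra_simps)
    have d_mono: "d i \<le> d j \<longleftrightarrow> i \<le> j" "d i < d j \<longleftrightarrow> i < j" for i j unfolding d_def using \<delta> by auto
    define S where "S = {s \<in> splits w \<gamma>. case s of (u, \<beta>, X, v) \<Rightarrow> length u < length w \<and> length v < length w}"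
    define cut where "cut = (\<lambda>i f r. \<exists>(u, \<beta>, X, v)\<in>S. chain u \<beta> f (r + d i) (r + d (Suc i)) \<and>
      X f (r + d (Suc i)) \<and> chain v \<gamma> f (r + d (Suc i)) (r + q))"
    define piece where "piece = (\<lambda>i f r. (if i \<le> n then forward w \<gamma> \<delta> f (r + d i)
      else backward (rev w) \<gamma> \<delta> f (r + d (Suc i))) \<and> (\<forall>u\<in>{r + d (Suc i)..<r + q}. \<gamma> f u))"
    have cut: "definable P (cut i)" if "Suc i < K" for i
      unfolding cut_def
    proof (rule definable_Bex)
      show "finite S" unfolding S_def by simp
      fix s assume "s \<in> S"
      moreover obtain u \<beta> X v where s: "s = (u, \<beta>, X, v)" by (cases s)
      ultimately have mem: "(u, \<beta>, X, v) \<in> splits w \<gamma>" "length u < length w" "length v < length w"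
        by (auto simp: S_def)
      show "definable P (\<lambda>f r. case s of (u, \<beta>, X, v) \<Rightarrow> chain u \<beta> f (r + d i) (r + d (Suc i)) \<and>
        X f (r + d (Suc i)) \<and> chain v \<gamma> f (r + d (Suc i)) (r + q))"
        unfolding s prod.case
        using definable_splits[OF mem(1) "1.prems"(1,2)] mem d(1-4) d_mono(2)[of "Suc i" K] that "1.prems"
        by (intro definable_conj IH definable_shift) auto
    qed
    have piece: "definable P (piece i)" for i
    proof -
      have "definable_list P (rev w)" using "1.prems"(1) by (simp add: definable_list_def)
      then have "definable P (\<lambda>f r. if i \<le> n then forward w \<gamma> \<delta> f (r + d i)
          else backward (rev w) \<gamma> \<delta> f (r + d (Suc i)))"
        using "1.prems" \<delta> d by (cases "i \<le> n") (auto intro!: definable_shift definable_forward definable_backward)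
      then show ?thesis unfolding piece_def
        using "1.prems" d(1) by (intro definable_conj definable_throughout_half_open) auto
    qed
    have "definable P (\<lambda>f r. \<exists>i\<in>{..<K}. (\<forall>u\<in>{r + 0<..r + d i}. fst p f u) \<and>
        ((if Suc i < K then cut i f r else False) \<or> piece i f r))"
    proof (intro definable_Bex definable_conj definable_disj definable_throughout_half_open piece d)
      show "definable P (\<lambda>f r. if Suc i < K then cut i f r else False)" for i
        using cut[of i] by (cases "Suc i < K") auto
    qed (use "1.prems" Cons in auto)
    moreover have "chain w \<gamma> f r (r + q) \<longleftrightarrow> (\<exists>i\<in>{..<K}. (\<forall>u\<in>{r + 0<..r + d i}. fst p f u) \<and>
        ((if Suc i < K then cut i f r else False) \<or> piece i f r))" (is "?l \<longleftrightarrow> ?r") for f r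
    proof
      assume ?l
      \<comment> \<open>\<open>G i\<close> says that the chain is still in its first gap at the i-th
        cut point. For the greatest such i, the next cut point is no longer in the first gap: it
        either splits the chain into shorter ones or lies in the last gap, so that all points of the
        chain are in piece i.\<close>
      define G where "G = (\<lambda>i. i < K \<and> (\<forall>u\<in>{r<..r + d i}. fst p f u) \<and> chain w \<gamma> f (r + d i) (r + q))"
      have "G 0" using \<open>?l\<close> by (simp add: G_def d K_def)
      moreover have bound: "\<And>j. G j \<Longrightarrow> j \<le> K" by (simp add: G_def)
      ultimately obtain i where i: "G i" "\<And>j. G j \<Longrightarrow> j \<le> i"
        using GreatestI_nat[of G 0 K] Greatest_le_nat[of G _ K] bound by blast
      have piece: "piece i f r"
        if chn: "chain w \<gamma> f (r + d i) (r + d (Suc i))" and \<gamma>: "\<forall>u\<in>{r + d (Suc i)..<r + q}. \<gamma> f u"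
      proof (cases "i \<le> n")
        case True
        then have "d (Suc i) + \<delta> \<le> q" using n d(4,5) d_mono(1)[of "Suc (Suc i)" K] by (simp add: K_def)
        then have "forward w \<gamma> \<delta> f (r + d i)"
          using chn \<gamma> d by (intro chain_imp_forward[of w \<gamma> f "r + d i" "r + d (Suc i)"]) auto
        then show ?thesis using True \<gamma> by (simp add: piece_def)
      next
        case False
        then have "\<delta> \<le> d i" using d(3,5) d_mono(1)[of 1 i] d(5)[of 0] by simp
        then have "\<forall>u\<in>{r + d i - \<delta><..r + d i}. last_gap (rev w) \<gamma> f u"
          using i(1) by (auto simp: G_def Cons)
        then have "backward (rev w) \<gamma> \<delta> f (r + d (Suc i))"
          using chn d by (intro chain_imp_backward[of "rev w" \<gamma> f "r + d i" "r + d (Suc i)"]) auto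
        then show ?thesis using False \<gamma> by (simp add: piece_def)
      qed
      have "(if Suc i < K then cut i f r else False) \<or> piece i f r"
      proof (cases "Suc i < K")
        case False
        then have "Suc i = K" using i(1) by (simp add: G_def)
        then show ?thesis using piece i(1) d(4) by (simp add: G_def)
      next
        case True
        then have lt: "d (Suc i) < q" using d(4) d_mono(2) by metis
        then obtain u \<beta> X v where s: "(u, \<beta>, X, v) \<in> splits (p # w') \<gamma>"
          "chain u \<beta> f (r + d i) (r + d (Suc i))" "X f (r + d (Suc i))"
          "chain v \<gamma> f (r + d (Suc i)) (r + q)"
          using chain_split[of "r + d i" "r + d (Suc i)" "r + q" w \<gamma> f] i(1) d(2)
          unfolding Cons G_def by (auto simp del: splits.simps chain.simps)
        from s(1) show ?thesis
        proof (cases rule: splits_cases)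
          case 1
          then have "(u, \<beta>, X, v) \<in> S" using s(1) by (auto simp: S_def Cons)
          then show ?thesis using s True unfolding cut_def by auto
        next
          case 2
          have "fst p f u" if "u \<in> {r<..r + d (Suc i)}" for u
            using i(1) that 2 s(2,3) unfolding G_def
            by (cases u "r + d (Suc i)" rule: linorder_cases; cases "u \<le> r + d i") auto
          then have "G (Suc i)" using True s(4) 2 unfolding G_def Cons by auto
          then show ?thesis using i(2) by fastforce
        next
          case 3
          then have "\<forall>u\<in>{r + d (Suc i)..<r + q}. \<gamma> f u" using s by (auto simp: le_less)
          then show ?thesis using piece 3 s(2) by (simp add: Cons)
        qed
      qed
      then show ?r using i(1) by (intro bexI[of _ i]) (auto simp: G_def)
    next
      assume ?r
      then obtain i where i: "i < K" "\<forall>u\<in>{r<..r + d i}. fst p f u"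
        "(Suc i < K \<and> cut i f r) \<or> piece i f r" by (auto split: if_splits)
      have le: "d (Suc i) \<le> q" using i(1) d(4) d_mono(1) by (metis Suc_leI)
      have ge: "0 \<le> d i" using d(3) d_mono(1) by (metis le0)
      have extend: "chain w \<gamma> f r (r + q)" if "chain w \<gamma> f (r + d i) (r + q)"
        using chain_extend_left[of p w' \<gamma> f "r + d i" "r + q" r] that i(2) ge unfolding Cons
        by (simp del: chain.simps)
      consider "Suc i < K" "cut i f r" | "i \<le> n" "piece i f r" | "i > n" "piece i f r"
        using i(3) by linarith
      then show ?l
      proof cases
        case 1
        then have lt: "d (Suc i) < q" using d(4) d_mono(2) by metis
        obtain u \<beta> X v where "(u, \<beta>, X, v) \<in> splits w \<gamma>"
          "chain u \<beta> f (r + d i) (r + d (Suc i))" "X f (r + d (Suc i))"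
          "chain v \<gamma> f (r + d (Suc i)) (r + q)"
          using 1(2) by (auto simp: cut_def S_def)
        then have "chain w \<gamma> f (r + d i) (r + q)"
          using chain_split[of "r + d i" "r + d (Suc i)" "r + q" w \<gamma> f] lt d(2)[of i] by auto
        then show ?thesis by (rule extend)
      next
        case 2
        have "d i + n * \<delta> = d (i + n)" by (simp add: d_def algebra_simps)
        also have "\<dots> \<le> q" using d(4) d_mono(1)[of "i + n" K] 2(1) by (simp add: K_def)
        finally have "chain w \<gamma> f (r + d i) (r + q)"
          using 2 d \<delta> by (intro forward_imp_chain[where \<delta> = \<delta> and c = "r + d (Suc i)"])
            (auto simp: piece_def n_def)
        then show ?thesis by (rule extend)
      next
        case 3
        have "d n \<le> d (Suc i)" using d_mono(1) 3(1) by simp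
        then have "n * \<delta> \<le> d (Suc i)" by (simp add: d_def)
        moreover have "backward (rev w) \<gamma> \<delta> f (r + d (Suc i))" using 3 by (simp add: piece_def)
        moreover have "last_gap (rev w) \<gamma> = fst p" by (simp add: Cons)
        ultimately have "chain (rev (rev w)) \<gamma> f r (r + d (Suc i))"
          using d(5)[of i] \<delta>(2) i(2)
          by (intro backward_imp_chain[where \<delta> = \<delta> and c = "r + d i"]) (auto simp: n_def)
        moreover have "\<forall>u\<in>{r + d (Suc i)..<r + q}. \<gamma> f u" using 3(2) by (simp add: piece_def)
        ultimately show ?thesis
          using chain_extend_right[of w \<gamma> f r "r + d (Suc i)" "r + q"] le by simp
      qed
    qed
    ultimately show ?thesis by simp
  qed
qed

lemma definable_intdef:
  assumes "intdef P R" "q \<in> \<rat>" "q > 0"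
  shows "definable P (\<lambda>f r. R f r (r + q))"
  using assms(1)
proof (induction R rule: intdef.induct)
  case (base A B w \<gamma>)
  then show ?case using assms by (intro definable_conj definable_chain definable_shift) auto
next
  case (cong R R')
  have "(\<lambda>f r. R' f r (r + q)) = (\<lambda>f r. R f r (r + q))" using cong.hyps assms(3) by simp
  then show ?case using cong.IH by simp
qed auto

section \<open>Relations on increasing points of a unit interval\<close>

text \<open>\<open>p 0\<close> is the value of the free variable, \<open>p 1\<close> to
  \<open>p m\<close> are further residues modulo 1, and \<open>p (Suc m)\<close> repeats
  \<open>p 0\<close> one unit later, so that the gaps cover a whole period.\<close>

definition grid :: "nat \<Rightarrow> (nat \<Rightarrow> real) \<Rightarrow> bool" where
  "grid m p \<longleftrightarrow> (\<forall>j\<le>m. p j < p (Suc j)) \<and> p (Suc m) = p 0 + 1"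

lemma grid_less: "grid m p \<Longrightarrow> i < j \<Longrightarrow> j \<le> Suc m \<Longrightarrow> p i < p j"
proof (induction j)
  case (Suc j)
  then have "p j < p (Suc j)" by (simp add: grid_def)
  then show ?case using Suc by (cases "i = j") auto
qed simp

lemma grid_le: "grid m p \<Longrightarrow> i \<le> j \<Longrightarrow> j \<le> Suc m \<Longrightarrow> p i \<le> p j"
  using grid_less[of m p i j] by (cases "i = j") auto

lemma grid_locate:
  assumes "grid m p" "p 0 \<le> c" "c < p 0 + 1"
  obtains j where "j \<le> m" "c = p j \<or> c \<in> {p j<..<p (Suc j)}"
proof -
  define j where "j = (GREATEST j. j \<le> m \<and> p j \<le> c)"
  have j: "j \<le> m" "p j \<le> c"
    using GreatestI_nat[of "\<lambda>j. j \<le> m \<and> p j \<le> c" 0 m] assms(2) unfolding j_def by auto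
  have "c < p (Suc j)"
  proof (rule ccontr)
    assume *: "\<not> c < p (Suc j)"
    show False
    proof (cases "j = m")
      case True
      then show ?thesis using * assms by (simp add: grid_def)
    next
      case False
      then have "Suc j \<le> j"
        unfolding j_def using * j(1) by (intro Greatest_le_nat[of _ _ m]) (auto simp: j_def)
      then show ?thesis by simp
    qed
  qed
  then show thesis using j that by (cases "c = p j") auto
qed

text \<open>Disjunctions of conjunctions of relations between neighbouring grid points. As with
  \<open>intdef\<close>, closure under conjunction and complement is proved rather than built in; it
  reduces to the corresponding closure for single gaps.\<close>

inductive multidef :: "'p set \<Rightarrow> nat \<Rightarrow> ((real \<Rightarrow> 'p set) \<Rightarrow> (nat \<Rightarrow> real) \<Rightarrow> bool) \<Rightarrow> bool" for P m where
  base: "(\<And>j. intdef P (R j)) \<Longrightarrow> multidef P m (\<lambda>f p. \<forall>j\<le>m. R j f (p j) (p (Suc j)))"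
| disj: "multidef P m Q \<Longrightarrow> multidef P m Q' \<Longrightarrow> multidef P m (\<lambda>f p. Q f p \<or> Q' f p)"
| cong: "multidef P m Q \<Longrightarrow> (\<And>f p. grid m p \<Longrightarrow> Q' f p \<longleftrightarrow> Q f p) \<Longrightarrow> multidef P m Q'"

lemma multidef_const: "multidef P m (\<lambda>f p. c)"
  by (rule multidef.cong[OF multidef.base[of P "\<lambda>_ _ _ _. c"]]) (auto intro: intdef_const)

lemma multidef_Bex:
  "finite A \<Longrightarrow> (\<And>i. i \<in> A \<Longrightarrow> multidef P m (Q i)) \<Longrightarrow> multidef P m (\<lambda>f p. \<exists>i\<in>A. Q i f p)"
  by (induction A rule: finite_induct) (auto intro: multidef_const multidef.disj)

lemma multidef_interval:
  assumes "intdef P R" "j \<le> m"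
  shows "multidef P m (\<lambda>f p. R f (p j) (p (Suc j)))"
  using assms
  by (intro multidef.cong[OF multidef.base[of P "\<lambda>i. if i = j then R else (\<lambda>_ _ _. True)"]])
    (auto intro: intdef_const)

lemma multidef_conj:
  assumes "multidef P m Q" "multidef P m Q'"
  shows "multidef P m (\<lambda>f p. Q f p \<and> Q' f p)"
  using assms
proof (induction Q rule: multidef.induct)
  case (base R)
  from base(2) show ?case
  proof (induction Q' rule: multidef.induct)
    case (base R')
    have "multidef P m (\<lambda>f p. \<forall>j\<le>m. R j f (p j) (p (Suc j)) \<and> R' j f (p j) (p (Suc j)))"
      using base \<open>\<And>j. intdef P (R j)\<close>
      by (intro multidef.base[of P "\<lambda>j f a b. R j f a b \<and> R' j f a b"] intdef_conj) auto
    then show ?case by (rule multidef.cong) auto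
  next
    case (disj Q1 Q2)
    show ?case by (rule multidef.cong[OF multidef.disj[OF disj.IH]]) auto
  next
    case (cong Q1 Q2)
    show ?case using cong.hyps by (intro multidef.cong[OF cong.IH]) auto
  qed
next
  case (disj Q1 Q2)
  show ?case by (rule multidef.cong[OF multidef.disj[OF disj.IH[OF disj.prems]]]) auto
next
  case (cong Q1 Q2)
  show ?case using cong.hyps by (intro multidef.cong[OF cong.IH[OF cong.prems]]) auto
qed

lemma multidef_not: "multidef P m Q \<Longrightarrow> multidef P m (\<lambda>f p. \<not> Q f p)"
proof (induction Q rule: multidef.induct)
  case (base R)
  have "multidef P m (\<lambda>f p. \<exists>j\<in>{..m}. \<not> R j f (p j) (p (Suc j)))"
    using base by (intro multidef_Bex multidef_interval[of P "\<lambda>f a b. \<not> R _ f a b"] intdef_not) auto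
  then show ?case by (rule multidef.cong) auto
next
  case (disj Q Q')
  show ?case by (rule multidef.cong[OF multidef_conj[OF disj.IH]]) auto
next
  case (cong Q Q')
  show ?case using cong.hyps by (intro multidef.cong[OF cong.IH]) auto
qed

section \<open>Eliminating a grid point\<close>

definition insert_point :: "nat \<Rightarrow> real \<Rightarrow> (nat \<Rightarrow> real) \<Rightarrow> nat \<Rightarrow> real" where
  "insert_point j z p i = (if i \<le> j then p i else if i = Suc j then z else p (i - 1))"

lemma grid_insert_point:
  assumes "grid m p" "j \<le> m" "z \<in> {p j<..<p (Suc j)}"
  shows "grid (Suc m) (insert_point j z p)"
  unfolding grid_def
proof (intro conjI allI impI)
  fix i assume "i \<le> Suc m"
  consider "i < j" | "i = j" | "i = Suc j" | "i > Suc j" by linarith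
  then show "insert_point j z p i < insert_point j z p (Suc i)"
  proof cases
    case 4
    then have "p (i - 1) < p i" using grid_less[OF assms(1), of "i - 1" i] \<open>i \<le> Suc m\<close> by simp
    then show ?thesis using 4 by (simp add: insert_point_def)
  qed (use assms in \<open>auto simp: insert_point_def grid_def\<close>)
qed (use assms in \<open>auto simp: insert_point_def grid_def\<close>)

text \<open>Only the two relations adjacent to the new point mention it, so quantifying it away
  composes them into one relation on gap j; the relations further right move down by one
  index.\<close>

lemma multidef_insert_point:
  assumes "multidef P (Suc m) Q" "j \<le> m"
  shows "multidef P m (\<lambda>f p. \<exists>z\<in>{p j<..<p (Suc j)}. Q f (insert_point j z p))"
  using assms(1)
proof (induction Q rule: multidef.induct)
  case (base R)
  define R' where "R' = (\<lambda>i. if i < j then R i else if i = j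
    then (\<lambda>f a b. \<exists>z\<in>{a<..<b}. R j f a z \<and> R (Suc j) f z b) else R (Suc i))"
  have "multidef P m (\<lambda>f p. \<forall>i\<le>m. R' i f (p i) (p (Suc i)))"
    using base by (intro multidef.base) (auto simp: R'_def intro: intdef_comp)
  then show ?case
  proof (rule multidef.cong)
    fix f p assume "grid m p"
    have "(\<forall>i\<le>Suc m. R i f (insert_point j z p i) (insert_point j z p (Suc i))) \<longleftrightarrow>
      R j f (p j) z \<and> R (Suc j) f z (p (Suc j)) \<and> (\<forall>i\<le>m. i \<noteq> j \<longrightarrow> R' i f (p i) (p (Suc i)))"
      (is "?l \<longleftrightarrow> ?r") for z
    proof
      assume l: ?l
      have "R j f (p j) z" "R (Suc j) f z (p (Suc j))"
        using l[rule_format, of j] l[rule_format, of "Suc j"] assms(2) by (auto simp: insert_point_def)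
      moreover have "R' i f (p i) (p (Suc i))" if "i \<le> m" "i \<noteq> j" for i
      proof (cases "i < j")
        case True
        then show ?thesis using l[rule_format, of i] that by (auto simp: insert_point_def R'_def)
      next
        case False
        then show ?thesis using l[rule_format, of "Suc i"] that by (auto simp: insert_point_def R'_def)
      qed
      ultimately show ?r by blast
    next
      assume r: ?r
      have "R i f (insert_point j z p i) (insert_point j z p (Suc i))" if "i \<le> Suc m" for i
      proof -
        consider "i < j" | "i = j" | "i = Suc j" | "i > Suc j" by linarith
        then show ?thesis
        proof cases
          case 1
          then have "R' i f (p i) (p (Suc i))" using r assms(2) by simp
          then show ?thesis using 1 by (simp add: R'_def insert_point_def)
        next
          case 4
          then obtain k where k: "i = Suc k" by (cases i) auto
          then have "R' k f (p k) (p (Suc k))" using r 4 that by auto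
          then show ?thesis using 4 k by (simp add: R'_def insert_point_def)
        qed (use r in \<open>simp_all add: insert_point_def\<close>)
      qed
      then show ?l by blast
    qed
    moreover have "(\<forall>i\<le>m. R' i f (p i) (p (Suc i))) \<longleftrightarrow>
      R' j f (p j) (p (Suc j)) \<and> (\<forall>i\<le>m. i \<noteq> j \<longrightarrow> R' i f (p i) (p (Suc i)))"
      using assms(2) by blast
    ultimately show "(\<exists>z\<in>{p j<..<p (Suc j)}. \<forall>i\<le>Suc m.
        R i f (insert_point j z p i) (insert_point j z p (Suc i))) \<longleftrightarrow>
      (\<forall>i\<le>m. R' i f (p i) (p (Suc i)))"
      by (auto simp: R'_def)
  qed
next
  case (disj Q Q')
  show ?case by (rule multidef.cong[OF multidef.disj[OF disj.IH]]) auto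
next
  case (cong Q Q')
  show ?case
    using cong.hyps grid_insert_point[OF _ assms(2)] by (intro multidef.cong[OF cong.IH]) blast
qed

text \<open>With \<open>m = 0\<close> the only gap runs from \<open>p 0\<close> to
  \<open>p 0 + 1\<close>, a fixed length, so a binary relation on it is a unary predicate of its
  left end.\<close>

lemma definable_multidef:
  assumes "multidef P 0 Q"
  shows "definable P (\<lambda>f r. Q f (\<lambda>j. r + real j))"
  using assms
proof (induction Q rule: multidef.induct)
  case (base R)
  then show ?case using definable_intdef[of P "R 0" 1] by simp
next
  case (cong Q Q')
  have "grid 0 (\<lambda>j. r + real j)" for r by (simp add: grid_def)
  then have "(\<lambda>f r. Q' f (\<lambda>j. r + real j)) = (\<lambda>f r. Q f (\<lambda>j. r + real j))"
    using cong.hyps by simp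
  then show ?case using cong.IH by simp
qed auto

section \<open>Bounded first-order formulas\<close>

primrec trm_shift :: "trm \<Rightarrow> nat" where
  "trm_shift (Var x) = 0"
| "trm_shift (Plus1 t) = Suc (trm_shift t)"

lemma trm_val_eq: "trm_val v t = v (trm_var t) + real (trm_shift t)"
  by (induction t) auto

lemma trm_val_plus_nat [simp]: "trm_val v (plus_nat x k) = v x + real k"
  unfolding plus_nat_def by (induction k) auto

lemma fo_sat_cong:
  "(\<And>y. y \<in> fo_free \<phi> \<Longrightarrow> v y = v' y) \<Longrightarrow> fo_sat f v \<phi> \<longleftrightarrow> fo_sat f v' \<phi>"
proof (induction \<phi> arbitrary: v v')
  case (ExF z \<phi>)
  have "fo_sat f (v(z := a)) \<phi> \<longleftrightarrow> fo_sat f (v'(z := a)) \<phi>" for a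
    using ExF.prems by (intro ExF.IH) auto
  then show ?case by simp
next
  case (AndF \<phi> \<psi>)
  have "fo_sat f v \<phi> \<longleftrightarrow> fo_sat f v' \<phi>" "fo_sat f v \<psi> \<longleftrightarrow> fo_sat f v' \<psi>"
    using AndF.prems by (intro AndF.IH; simp)+
  then show ?case by simp
next
  case (NotF \<phi>)
  have "fo_sat f v \<phi> \<longleftrightarrow> fo_sat f v' \<phi>" using NotF.prems by (intro NotF.IH) simp
  then show ?case by simp
next
  case (Pred q t)
  then have "v (trm_var t) = v' (trm_var t)" by simp
  then show ?case by (simp add: trm_val_eq)
next
  case (Less s t)
  then have "v (trm_var s) = v' (trm_var s)" "v (trm_var t) = v' (trm_var t)" by simp_all
  then show ?case by (simp add: trm_val_eq)
qed simp

lemma fo_sat_between: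
  "fo_sat f v (between (Offset x (- int N)) z (Offset x (int N))) \<longleftrightarrow> v x - N \<le> v z \<and> v z < v x + N"
  by (simp add: between_def not_less diff_le_eq)

text \<open>
  Every variable y is placed at p (J y) + I y, a point of the unit interval starting at the value of x
  moved by an integer. An order atom then depends on I and J only.
\<close>

lemma multidef_fo_sat:
  assumes "bet_under (Offset x (- int N)) (Offset x (int N)) B \<phi>" "fo_preds \<phi> \<subseteq> P"
    and "\<forall>y. J y \<le> m" "J x = 0" "I x = (0::int)"
  shows "multidef P m (\<lambda>f p. fo_sat f (\<lambda>y. p (J y) + of_int (I y)) \<phi>)"
  using assms
proof (induction \<phi> arbitrary: B m I J)
  case TrueF
  then show ?case by (simp add: multidef_const)
next
  case (Pred q t)
  \<comment> \<open>An integer shift turns the atom into a condition at a grid point, which is then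
    read as a left end condition of the gap starting there; such a gap exists because indices are at
    most m.\<close>
  have "definable P (\<lambda>f r. q \<in> f (r + (of_int (I (trm_var t)) + real (trm_shift t))))"
    using Pred.prems(2) by (intro definable_shift definable_prop) auto
  then have "intdef P (\<lambda>f a b. q \<in> f (a + (of_int (I (trm_var t)) + real (trm_shift t))))"
    by (rule intdef_left)
  then have "multidef P m (\<lambda>f p. q \<in> f (p (J (trm_var t)) + (of_int (I (trm_var t)) + real (trm_shift t))))"
    using Pred.prems(3) by (intro multidef_interval) auto
  then show ?case by (simp add: trm_val_eq add.assoc)
next
  case (Less s t)
  \<comment> \<open>The total integer offset between the two sides. Two grid points differ by less
    than 1, so a nonzero \<open>d\<close> decides the comparison, and for \<open>d = 0\<close> the
    indices do.\<close>
  define d where "d = I (trm_var t) + int (trm_shift t) - I (trm_var s) - int (trm_shift s)"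
  show ?case
  proof (rule multidef.cong[OF multidef_const])
    fix f :: "real \<Rightarrow> 'a set" and p assume p: "grid m p"
    let ?s = "p (J (trm_var s))" and ?t = "p (J (trm_var t))"
    have bounds: "p 0 \<le> p (J y)" "p (J y) < p 0 + 1" for y
      using grid_le[OF p, of 0 "J y"] grid_less[OF p, of "J y" "Suc m"] p Less.prems(3)
      by (auto simp: grid_def le_Suc_eq less_Suc_eq_le)
    have J_less: "?s < ?t \<longleftrightarrow> J (trm_var s) < J (trm_var t)"
      using grid_less[OF p, of "J (trm_var s)" "J (trm_var t)"]
        grid_le[OF p, of "J (trm_var t)" "J (trm_var s)"] Less.prems(3)
      by (metis le_SucI not_le)
    have "fo_sat f (\<lambda>y. p (J y) + of_int (I y)) (Less s t) \<longleftrightarrow> ?s < ?t + of_int d"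
      by (auto simp: trm_val_eq d_def)
    also have "\<dots> \<longleftrightarrow> d \<ge> 1 \<or> d = 0 \<and> J (trm_var s) < J (trm_var t)"
    proof -
      consider "d \<ge> 1" | "d = 0" | "d \<le> -1" by linarith
      then show ?thesis
      proof cases
        case 1
        then have "real_of_int d \<ge> 1" by simp
        then have "?s < ?t + of_int d" using bounds[of "trm_var s"] bounds[of "trm_var t"] by linarith
        then show ?thesis using 1 by simp
      next
        case 2
        then show ?thesis using J_less by simp
      next
        case 3
        then have "real_of_int d \<le> -1" by simp
        then have "\<not> ?s < ?t + of_int d" using bounds[of "trm_var s"] bounds[of "trm_var t"] by linarith
        then show ?thesis using 3 by simp
      qed
    qed
    finally show "fo_sat f (\<lambda>y. p (J y) + of_int (I y)) (Less s t) \<longleftrightarrow>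
      (d \<ge> 1 \<or> d = 0 \<and> J (trm_var s) < J (trm_var t))" .
  qed
next
  case (AndF \<phi> \<psi>)
  have "multidef P m (\<lambda>f p. fo_sat f (\<lambda>y. p (J y) + of_int (I y)) \<phi> \<and>
      fo_sat f (\<lambda>y. p (J y) + of_int (I y)) \<psi>)"
    using AndF.prems by (intro multidef_conj AndF.IH[of B]) auto
  then show ?case by simp
next
  case (NotF \<phi>)
  have "multidef P m (\<lambda>f p. \<not> fo_sat f (\<lambda>y. p (J y) + of_int (I y)) \<phi>)"
    using NotF.prems by (intro multidef_not NotF.IH[of B]) auto
  then show ?case by simp
next
  case (ExF z \<psi>)
  have z: "z \<noteq> x" using ExF.prems(1) by simp
  obtain \<chi> where \<psi>: "\<psi> = AndF (between (Offset x (- int N)) z (Offset x (int N))) \<chi>"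
    using ExF.prems(1) by auto
  \<comment> \<open>The quantified variable falls modulo 1 either on an existing grid point or
    strictly inside a gap. Since \<open>z\<close> differs from \<open>x\<close>, the placement of
    \<open>x\<close> at \<open>p 0\<close> with shift 0 survives both updates.\<close>
  define at_point where "at_point = (\<lambda>i j f p. fo_sat f (\<lambda>y. p ((J(z := j)) y) + of_int ((I(z := i)) y)) \<psi>)"
  \<comment> \<open>A point inserted into gap j gets index \<open>Suc j\<close>, and all points
    after j move up by one.\<close>
  define J' where "J' = (\<lambda>j y. if J y \<le> j then J y else Suc (J y))"
  define in_gap where "in_gap = (\<lambda>i j f p. fo_sat f (\<lambda>y. p (((J' j)(z := Suc j)) y) + of_int ((I(z := i)) y)) \<psi>)"
  have bet: "bet_under (Offset x (- int N)) (Offset x (int N)) (insert z B) \<psi>" "fo_preds \<psi> \<subseteq> P"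
    using ExF.prems(1,2) by auto
  have "multidef P m (at_point i j)" if "j \<in> {..m}" for i j
    unfolding at_point_def using ExF.prems z that by (intro ExF.IH[OF bet]) auto
  moreover have "multidef P m (\<lambda>f p. \<exists>c\<in>{p j<..<p (Suc j)}. in_gap i j f (insert_point j c p))"
    if "j \<in> {..m}" for i j
    unfolding in_gap_def using ExF.prems z that
    by (intro multidef_insert_point ExF.IH[OF bet]) (auto simp: J'_def)
  ultimately have "multidef P m (\<lambda>f p. \<exists>i\<in>{- int N..<int N}. (\<exists>j\<in>{..m}. at_point i j f p) \<or>
    (\<exists>j\<in>{..m}. \<exists>c\<in>{p j<..<p (Suc j)}. in_gap i j f (insert_point j c p)))"
    by (intro multidef_Bex multidef.disj) auto
  then show ?case
  proof (rule multidef.cong)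
    fix f :: "real \<Rightarrow> 'a set" and p assume p: "grid m p"
    let ?v = "\<lambda>y. p (J y) + of_int (I y)"
    have at_point: "at_point i j f p \<longleftrightarrow> fo_sat f (?v(z := p j + of_int i)) \<psi>" for i j
      unfolding at_point_def by (rule arg_cong[where f = "\<lambda>v. fo_sat f v \<psi>"]) auto
    have in_gap: "in_gap i j f (insert_point j c p) \<longleftrightarrow> fo_sat f (?v(z := c + of_int i)) \<psi>" for i j c
      unfolding in_gap_def
      by (rule arg_cong[where f = "\<lambda>v. fo_sat f v \<psi>"]) (auto simp: J'_def insert_point_def)
    show "fo_sat f ?v (ExF z \<psi>) \<longleftrightarrow> (\<exists>i\<in>{- int N..<int N}. (\<exists>j\<in>{..m}. at_point i j f p) \<or>
      (\<exists>j\<in>{..m}. \<exists>c\<in>{p j<..<p (Suc j)}. in_gap i j f (insert_point j c p)))"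
    proof
      assume "fo_sat f ?v (ExF z \<psi>)"
      then obtain a where a: "fo_sat f (?v(z := a)) \<psi>" by auto
      then have "fo_sat f (?v(z := a)) (between (Offset x (- int N)) z (Offset x (int N)))"
        unfolding \<psi> by simp
      then have range: "p 0 - N \<le> a" "a < p 0 + N"
        unfolding fo_sat_between using z ExF.prems(4,5) by auto
      \<comment> \<open>The whole number of units from the value of \<open>x\<close> to
        \<open>a\<close>. The range of the quantifier bounds it by \<open>- N \<le> i < N\<close>,
        so the disjunction over shifts is finite.\<close>
      define i where "i = \<lfloor>a - p 0\<rfloor>"
      have i: "i \<in> {- int N..<int N}" unfolding i_def using range by (auto simp: le_floor_iff floor_less_iff)
      have "p 0 \<le> a - of_int i" "a - of_int i < p 0 + 1" unfolding i_def by linarith+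
      then obtain j where j: "j \<le> m" "a - of_int i = p j \<or> a - of_int i \<in> {p j<..<p (Suc j)}"
        by (rule grid_locate[OF p])
      from j(2) show "\<exists>i\<in>{- int N..<int N}. (\<exists>j\<in>{..m}. at_point i j f p) \<or>
        (\<exists>j\<in>{..m}. \<exists>c\<in>{p j<..<p (Suc j)}. in_gap i j f (insert_point j c p))"
      proof
        assume "a - of_int i = p j"
        then have "a = p j + of_int i" by simp
        then have "at_point i j f p" unfolding at_point using a by simp
        then show ?thesis using i j(1) by blast
      next
        assume "a - of_int i \<in> {p j<..<p (Suc j)}"
        moreover have "in_gap i j f (insert_point j (a - of_int i) p)" unfolding in_gap using a by simp
        ultimately show ?thesis using i j(1) by blast
      qed
    qed (auto simp: at_point in_gap)
  qed
qed

theorem theorem4: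
  fixes P :: "'p set" and N x :: nat and \<phi> :: "'p fo"
  assumes "finite P"
    and "N > 0"
    and "fo_preds \<phi> \<subseteq> P"
    and "N_bounded N x \<phi>"
  shows "\<exists>\<phi>'. \<phi>' \<in> mtl_formulas P \<and>
    (\<forall>f r v. signal P f \<longrightarrow> (fo_sat f (v(x := r)) \<phi> \<longleftrightarrow> mtl_sat f r \<phi>'))"
proof -
  have free: "fo_free \<phi> \<subseteq> {x}" and bet: "bet_under (Offset x (- int N)) (Offset x (int N)) {} \<phi>"
    using assms(4) by (auto simp: N_bounded_def Bet_def)
  \<comment> \<open>All variables start at the value of \<open>x\<close>; since no other variable is
    free, this valuation represents every valuation that sends \<open>x\<close> to r.\<close>
  have "multidef P 0 (\<lambda>f p. fo_sat f (\<lambda>y. p 0 + of_int 0) \<phi>)"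
    using multidef_fo_sat[OF bet assms(3), of "\<lambda>_. 0" 0 "\<lambda>_. 0"] by simp
  then have "definable P (\<lambda>f r. fo_sat f (\<lambda>y. r) \<phi>)"
    using definable_multidef by fastforce
  then obtain \<phi>' where \<phi>': "\<phi>' \<in> mtl_formulas P" "(\<lambda>f r. fo_sat f (\<lambda>y. r) \<phi>) = (\<lambda>f r. mtl_sat f r \<phi>')"
    unfolding definable_def by blast
  moreover have "fo_sat f (v(x := r)) \<phi> \<longleftrightarrow> fo_sat f (\<lambda>y. r) \<phi>" for f r v
    using free by (intro fo_sat_cong) auto
  ultimately show ?thesis by (intro exI[of _ \<phi>']) (simp add: fun_eq_iff)
qed

end
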